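(* Let $A,B,C\subset\mathbb{H}_n$ be small. Then the following are equivalent: (1) $A\mathop{\perp\!\!\!\perp}^f_C B$; (2) $A\mathop{\perp\!\!\!\perp}^d_C B$; (3) $A\cap B\subseteq C$ and, for every tuple $\bar b$ of elements of $B\setminus C$, $K_n(\bar b/A\cup C)$ implies $K_n(\bar b/C)$.
   Context: Fix $n\ge3$; $K_m$ is the complete graph on $m$ vertices. Language $\{R\}$, $R$ the symmetric irreflexive edge relation. $T_n$ is the complete theory of the generic $K_n$-free (Henson) graph: the unique countable $K_n$-free graph into which every finite $K_n$-free graph embeds as an induced subgraph and in which every isomorphism between finite induced subgraphs extends to an automorphism. $\mathbb{H}_n$ is a sufficiently saturated monster model of $T_n$; "$C\subset\mathbb{H}_n$" means $C$ is small. Dividing: a partial type $\pi(\bar x,\bar b)$ divides over $C$ if there is a $C$-indiscernible sequence $(\bar b^l)_{l<\omega}$ with $\bar b^0=\bar b$ such that $\bigcup_l\pi(\bar x,\bar b^l)$ is inconsistent. Forking: $\pi(\bar x,\bar b)$ forks over $C$ if there is $D\supseteq\bar b\cup C$ such that every complete type over $D$ extending $\pi(\bar x,\bar b)$ divides over $C$. $A\mathop{\perp\!\!\!\perp}^d_C B$ (resp. $A\mathop{\perp\!\!\!\perp}^f_C B$) means $\operatorname{tp}(A/B\cup C)$ does not divide (resp. does not fork) over $C$. $K_n(X/Y)$ (for disjoint subsets $X,Y$; for a tuple use its set of entries): there is $X_0\subseteq X\cup Y$ with $|X_0|=n$, $X_0\cap Y\ne\emptyset\ne X_0\cap X$, distinct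 elements of $X_0\cap Y$ pairwise adjacent, and every element of $X_0\cap X$ adjacent to every element of $X_0\cap Y$. *)

theory Defs
  imports "HOL-Library.Countable_Set"
begin

unbundle cardinal_syntax

text \<open>First-order formulas in the language with one binary relation symbol. A structure is a
  binary relation whose universe is the whole type.\<close>

datatype fm =
    Eq nat nat
  | Adj nat nat
  | Neg fm
  | Conj fm fm
  | Exi nat fm

fun fv :: "fm \<Rightarrow> nat set" where
  "fv (Eq i j) = {i, j}"
| "fv (Adj i j) = {i, j}"
| "fv (Neg \<phi>) = fv \<phi>"
| "fv (Conj \<phi> \<psi>) = fv \<phi> \<union> fv \<psi>"
| "fv (Exi i \<phi>) = fv \<phi> - {i}"

fun sat :: "('a \<Rightarrow> 'a \<Rightarrow> bool) \<Rightarrow> (nat \<Rightarrow> 'a) \<Rightarrow> fm \<Rightarrow> bool" where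
  "sat E s (Eq i j) \<longleftrightarrow> s i = s j"
| "sat E s (Adj i j) \<longleftrightarrow> E (s i) (s j)"
| "sat E s (Neg \<phi>) \<longleftrightarrow> \<not> sat E s \<phi>"
| "sat E s (Conj \<phi> \<psi>) \<longleftrightarrow> sat E s \<phi> \<and> sat E s \<psi>"
| "sat E s (Exi i \<phi>) \<longleftrightarrow> (\<exists>a. sat E (s(i := a)) \<phi>)"

definition complete_theory :: "('a \<Rightarrow> 'a \<Rightarrow> bool) \<Rightarrow> fm set" where
  "complete_theory E = {\<phi>. fv \<phi> = {} \<and> (\<forall>s. sat E s \<phi>)}"

definition models :: "('a \<Rightarrow> 'a \<Rightarrow> bool) \<Rightarrow> fm set \<Rightarrow> bool" where
  "models E T \<longleftrightarrow> (\<forall>\<phi>\<in>T. \<forall>s. sat E s \<phi>)"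

text \<open>A pair of a formula and a map \<open>\<sigma>\<close> stands for the formula in which each free
  variable \<open>i\<close> is replaced by the entry of a variable tuple (\<open>\<sigma> i = Inl x\<close>) or of a parameter
  tuple (\<open>\<sigma> i = Inr y\<close>). Both tuples may be infinite: they are families
  with index types \<open>'x\<close> and \<open>'y\<close>. Formulas with parameters from the structure itself are the
  case \<open>'y = 'a\<close>, where every parameter indexes itself. Only the values of \<open>\<sigma>\<close> on the free
  variables matter.\<close>

type_synonym ('x, 'y) formula = "fm \<times> (nat \<Rightarrow> 'x + 'y)"

definition formulas :: "'x set \<Rightarrow> 'y set \<Rightarrow> ('x, 'y) formula set" where
  "formulas X Y = {(\<phi>, \<sigma>). \<sigma> ` fv \<phi> \<subseteq> X <+> Y}"

definition subst_params :: "('y \<Rightarrow> 'a) \<Rightarrow> ('x, 'y) formula \<Rightarrow> ('x, 'a) formula" where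
  "subst_params b = (\<lambda>(\<phi>, \<sigma>). (\<phi>, map_sum id b \<circ> \<sigma>))"

definition holds :: "('a \<Rightarrow> 'a \<Rightarrow> bool) \<Rightarrow> ('x \<Rightarrow> 'a) \<Rightarrow> ('x, 'a) formula \<Rightarrow> bool" where
  "holds E a = (\<lambda>(\<phi>, \<sigma>). sat E (case_sum a id \<circ> \<sigma>) \<phi>)"

definition realizes :: "('a \<Rightarrow> 'a \<Rightarrow> bool) \<Rightarrow> ('x \<Rightarrow> 'a) \<Rightarrow> ('x, 'a) formula set \<Rightarrow> bool" where
  "realizes E a p \<longleftrightarrow> (\<forall>\<psi>\<in>p. holds E a \<psi>)"

definition consistent :: "('a \<Rightarrow> 'a \<Rightarrow> bool) \<Rightarrow> ('x, 'a) formula set \<Rightarrow> bool" where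
  "consistent E p \<longleftrightarrow> (\<forall>F\<subseteq>p. finite F \<longrightarrow> (\<exists>a. realizes E a F))"

definition complete_type ::
    "('a \<Rightarrow> 'a \<Rightarrow> bool) \<Rightarrow> 'x set \<Rightarrow> 'a set \<Rightarrow> ('x, 'a) formula set \<Rightarrow> bool" where
  "complete_type E X D p \<longleftrightarrow> p \<subseteq> formulas X D \<and> consistent E p \<and>
     (\<forall>(\<phi>, \<sigma>)\<in>formulas X D. (\<phi>, \<sigma>) \<in> p \<or> (Neg \<phi>, \<sigma>) \<in> p)"

text \<open>The type over \<open>D\<close> of the tuple \<open>(a x)\<close> indexed by \<open>x \<in> X\<close>.\<close>

definition tp :: "('a \<Rightarrow> 'a \<Rightarrow> bool) \<Rightarrow> ('x \<Rightarrow> 'a) \<Rightarrow> 'x set \<Rightarrow> 'a set \<Rightarrow> ('x, 'a) formula set" where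
  "tp E a X D = {\<psi> \<in> formulas X D. holds E a \<psi>}"

definition small :: "'k rel \<Rightarrow> 'a set \<Rightarrow> bool" where
  "small \<kappa> A \<longleftrightarrow> |A| <o \<kappa>"

definition saturated :: "'k rel \<Rightarrow> ('a \<Rightarrow> 'a \<Rightarrow> bool) \<Rightarrow> bool" where
  "saturated \<kappa> E \<longleftrightarrow>
     (\<forall>D p. small \<kappa> D \<longrightarrow> complete_type E (UNIV :: unit set) D p \<longrightarrow> (\<exists>a. realizes E a p))"

definition monster_model :: "'k rel \<Rightarrow> fm set \<Rightarrow> ('a \<Rightarrow> 'a \<Rightarrow> bool) \<Rightarrow> bool" where
  "monster_model \<kappa> T E \<longleftrightarrow> Card_order \<kappa> \<and> natLeq <o \<kappa> \<and> models E T \<and> saturated \<kappa> E"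

text \<open>\<open>bs l\<close> is the \<open>l\<close>-th tuple of the sequence, a family indexed by \<open>J\<close>.\<close>

definition indiscernible ::
    "('a \<Rightarrow> 'a \<Rightarrow> bool) \<Rightarrow> 'a set \<Rightarrow> 'y set \<Rightarrow> (nat \<Rightarrow> 'y \<Rightarrow> 'a) \<Rightarrow> bool" where
  "indiscernible E C J bs \<longleftrightarrow>
     (\<forall>(k :: nat) f g. strict_mono_on {..<k} f \<longrightarrow> strict_mono_on {..<k} g \<longrightarrow>
        tp E (\<lambda>(m, y). bs (f m) y) ({..<k} \<times> J) C = tp E (\<lambda>(m, y). bs (g m) y) ({..<k} \<times> J) C)"

text \<open>In the next two definitions \<open>p\<close> is the partial type in a variable tuple and a parameter
  tuple, and \<open>b\<close>, indexed by \<open>J\<close>, is the tuple put in for the parameters.\<close>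

definition divides ::
    "('a \<Rightarrow> 'a \<Rightarrow> bool) \<Rightarrow> 'a set \<Rightarrow> ('x, 'y) formula set \<Rightarrow> 'y set \<Rightarrow> ('y \<Rightarrow> 'a) \<Rightarrow> bool" where
  "divides E C p J b \<longleftrightarrow>
     (\<exists>bs. (\<forall>j\<in>J. bs 0 j = b j) \<and> indiscernible E C J bs \<and>
        \<not> consistent E (\<Union>l. subst_params (bs l) ` p))"

definition forks ::
    "'k rel \<Rightarrow> ('a \<Rightarrow> 'a \<Rightarrow> bool) \<Rightarrow> 'a set \<Rightarrow> 'x set \<Rightarrow> ('x, 'y) formula set \<Rightarrow> 'y set \<Rightarrow> ('y \<Rightarrow> 'a) \<Rightarrow> bool"
  where
  "forks \<kappa> E C X p J b \<longleftrightarrow>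
     (\<exists>D. small \<kappa> D \<and> b ` J \<union> C \<subseteq> D \<and>
        (\<forall>q. complete_type E X D q \<and> subst_params b ` p \<subseteq> q \<longrightarrow> divides E C q D id))"

text \<open>\<open>A\<close> and \<open>B \<union> C\<close> are enumerated by themselves.\<close>

definition indep_d :: "('a \<Rightarrow> 'a \<Rightarrow> bool) \<Rightarrow> 'a set \<Rightarrow> 'a set \<Rightarrow> 'a set \<Rightarrow> bool" where
  "indep_d E A C B \<longleftrightarrow> \<not> divides E C (tp E id A (B \<union> C)) (B \<union> C) id"

definition indep_f :: "'k rel \<Rightarrow> ('a \<Rightarrow> 'a \<Rightarrow> bool) \<Rightarrow> 'a set \<Rightarrow> 'a set \<Rightarrow> 'a set \<Rightarrow> bool" where
  "indep_f \<kappa> E A C B \<longleftrightarrow> \<not> forks \<kappa> E C A (tp E id A (B \<union> C)) (B \<union> C) id"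

definition K_free_graph :: "nat \<Rightarrow> 'v set \<Rightarrow> ('v \<Rightarrow> 'v \<Rightarrow> bool) \<Rightarrow> bool" where
  "K_free_graph n V E \<longleftrightarrow>
     (\<forall>x\<in>V. \<forall>y\<in>V. E x y \<longrightarrow> E y x) \<and> (\<forall>x\<in>V. \<not> E x x) \<and>
     \<not> (\<exists>X\<subseteq>V. finite X \<and> card X = n \<and> pairwise E X)"

definition induced_embedding ::
    "'v set \<Rightarrow> ('v \<Rightarrow> 'v \<Rightarrow> bool) \<Rightarrow> ('w \<Rightarrow> 'w \<Rightarrow> bool) \<Rightarrow> ('v \<Rightarrow> 'w) \<Rightarrow> bool" where
  "induced_embedding V F G f \<longleftrightarrow> inj_on f V \<and> (\<forall>x\<in>V. \<forall>y\<in>V. G (f x) (f y) \<longleftrightarrow> F x y)"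

text \<open>In the last clause, an isomorphism between finite induced subgraphs is an induced embedding
  of its domain, and an automorphism is a surjective induced embedding of the whole graph.\<close>

definition henson_graph :: "nat \<Rightarrow> ('v \<Rightarrow> 'v \<Rightarrow> bool) \<Rightarrow> bool" where
  "henson_graph n G \<longleftrightarrow>
     countable (UNIV :: 'v set) \<and> K_free_graph n UNIV G \<and>
     (\<forall>(V :: nat set) F. finite V \<and> K_free_graph n V F \<longrightarrow> (\<exists>f. induced_embedding V F G f)) \<and>
     (\<forall>S f. finite S \<and> induced_embedding S G G f \<longrightarrow>
        (\<exists>g. induced_embedding UNIV G G g \<and> surj g \<and> (\<forall>x\<in>S. g x = f x)))"

text \<open>\<open>K_rel n E X Y\<close> is $K_n(X/Y)$; it is only meant for disjoint \<open>X\<close> and \<open>Y\<close>.\<close>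

definition K_rel :: "nat \<Rightarrow> ('a \<Rightarrow> 'a \<Rightarrow> bool) \<Rightarrow> 'a set \<Rightarrow> 'a set \<Rightarrow> bool" where
  "K_rel n E X Y \<longleftrightarrow>
     (\<exists>Z\<subseteq>X \<union> Y. finite Z \<and> card Z = n \<and> Z \<inter> Y \<noteq> {} \<and> Z \<inter> X \<noteq> {} \<and>
        pairwise E (Z \<inter> Y) \<and> (\<forall>x\<in>Z \<inter> X. \<forall>y\<in>Z \<inter> Y. E x y))"

text \<open>Finite tuples suffice in statements about all tuples from a set: infinite ones, whose entries
  form an arbitrary subset, give the same condition.\<close>

lemma K_rel_lists_iff_subsets:
  "(\<forall>bs. set bs \<subseteq> B - C \<longrightarrow> K_rel n E (set bs) (A \<union> C) \<longrightarrow> K_rel n E (set bs) C) \<longleftrightarrow>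
         (\<forall>X. X \<subseteq> B - C \<longrightarrow> K_rel n E X (A \<union> C) \<longrightarrow> K_rel n E X C)" (is "?L \<longleftrightarrow> ?R")
proof
  assume L: ?L
  show ?R
  proof (intro allI impI)
    fix X assume X: "X \<subseteq> B - C" and K: "K_rel n E X (A \<union> C)"
    obtain Z where Z: "Z \<subseteq> X \<union> (A \<union> C)" "finite Z" "card Z = n" "Z \<inter> (A \<union> C) \<noteq> {}" "Z \<inter> X \<noteq> {}"
      "pairwise E (Z \<inter> (A \<union> C))" "\<forall>x\<in>Z \<inter> X. \<forall>y\<in>Z \<inter> (A \<union> C). E x y"
      using K unfolding K_rel_def by auto
    obtain bs where bs: "set bs = Z \<inter> X" using finite_list Z(2) by blast
    have "K_rel n E (set bs) (A \<union> C)"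
      unfolding K_rel_def bs using Z by (intro exI[of _ Z]) auto
    moreover have "set bs \<subseteq> B - C" using bs X by auto
    ultimately have "K_rel n E (set bs) C" using L by blast
    then obtain W where W: "W \<subseteq> Z \<inter> X \<union> C" "finite W" "card W = n" "W \<inter> C \<noteq> {}" "W \<inter> (Z \<inter> X) \<noteq> {}"
      "pairwise E (W \<inter> C)" "\<forall>x\<in>W \<inter> (Z \<inter> X). \<forall>y\<in>W \<inter> C. E x y"
      unfolding K_rel_def bs by auto
    have "W \<inter> X = W \<inter> (Z \<inter> X)" using W(1) X by auto
    then show "K_rel n E X C"
      unfolding K_rel_def using W by (intro exI[of _ W]) auto
  qed
qed auto

end

theory Submission
  imports Defs
begin

text \<open>Quantifier elimination turns types into graphs, and saturation realizes every small
  \<open>K\<^sub>n\<close>-free graph over a small subset of the monster model.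

  If the combinatorial condition fails at a set \<open>X\<close> of fewer than \<open>n\<close> elements of \<open>B - C\<close>, take
  infinitely many copies of \<open>B\<close> over \<open>C\<close>, the copies \<open>x\<^sup>l\<close> and \<open>y\<^sup>m\<close> being adjacent for distinct
  \<open>x, y\<close> in \<open>X\<close> and \<open>l \<noteq> m\<close>. This graph is \<open>K\<^sub>n\<close>-free as \<open>X\<close> has no \<open>K\<^sub>n\<close> over \<open>C\<close>, and a common
  realization of the copies of the type of \<open>A\<close> would complete a transversal of \<open>X\<close> to a \<open>K\<^sub>n\<close>.

  Conversely, let \<open>A'\<close> be a copy of \<open>A\<close> in the free amalgam with \<open>D\<close> over \<open>B \<union> C\<close>; the condition
  passes to \<open>A'\<close> and \<open>D\<close>. Along a \<open>C\<close>-indiscernible sequence of copies of \<open>D\<close>, join a new copy of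
  \<open>A'\<close> to each copy of \<open>D\<close> as \<open>A'\<close> is joined to \<open>D\<close>. A \<open>K\<^sub>n\<close> in the result meets each family
  \<open>(d\<^sup>l)\<^sub>l\<close> at most once, for otherwise that family would be an infinite complete graph. It projects
  to a \<open>K\<^sub>n\<close> of \<open>D - C\<close> over \<open>A' \<union> C\<close>, and the resulting \<open>K\<^sub>n\<close> over \<open>C\<close> lifts to a complete
  graph on \<open>n\<close> vertices of the monster model, a contradiction.\<close>

section \<open>Axioms of the generic \<open>K\<^sub>n\<close>-free graph\<close>

text \<open>A theory consists of sentences, whereas the axioms below have free variables. Both
  equivalences go through a single induction because one and the same closure must serve
  \<open>G\<close> and \<open>E\<close>.\<close>

lemma universal_closure:
  assumes "finite I"
  shows "\<exists>\<psi>. fv \<psi> = fv \<phi> - I \<and> ((\<forall>s. sat G s \<psi>) \<longleftrightarrow> (\<forall>s. sat G s \<phi>)) \<and>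
    ((\<forall>s. sat E s \<psi>) \<longleftrightarrow> (\<forall>s. sat E s \<phi>))"
  using assms
proof (induction I)
  case empty
  show ?case by auto
next
  case (insert i I)
  then obtain \<psi> where \<psi>: "fv \<psi> = fv \<phi> - I" "(\<forall>s. sat G s \<psi>) \<longleftrightarrow> (\<forall>s. sat G s \<phi>)"
    "(\<forall>s. sat E s \<psi>) \<longleftrightarrow> (\<forall>s. sat E s \<phi>)"
    by auto
  have all: "(\<forall>s. sat H s (Neg (Exi i (Neg \<psi>)))) \<longleftrightarrow> (\<forall>s. sat H s \<psi>)" for H :: "'c \<Rightarrow> 'c \<Rightarrow> bool"
    by simp (metis fun_upd_triv)
  show ?case
    using \<psi> by (intro exI[of _ "Neg (Exi i (Neg \<psi>))"]) (auto simp only: all fv.simps)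
qed

lemma finite_fv: "finite (fv \<phi>)"
  by (induction \<phi>) auto

lemma models_transfer:
  assumes "models E (complete_theory G)" and "\<And>s. sat G s \<phi>"
  shows "sat E s \<phi>"
proof -
  obtain \<psi> where "fv \<psi> = {}" "\<forall>s. sat G s \<psi>" "(\<forall>s. sat E s \<psi>) \<longleftrightarrow> (\<forall>s. sat E s \<phi>)"
    using universal_closure[OF finite_fv[of \<phi>], of \<phi> G E] assms(2) by auto
  with assms(1) show ?thesis
    unfolding models_def complete_theory_def by blast
qed

section \<open>Finite graphs described by formulas\<close>

fun conjs :: "fm list \<Rightarrow> fm" where
  "conjs [] = Eq 0 0"
| "conjs (\<phi> # \<phi>s) = Conj \<phi> (conjs \<phi>s)"

lemma sat_conjs [simp]: "sat E s (conjs \<phi>s) \<longleftrightarrow> (\<forall>\<phi>\<in>set \<phi>s. sat E s \<phi>)"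
  by (induction \<phi>s) auto

definition diagram :: "nat \<Rightarrow> (nat \<Rightarrow> nat \<Rightarrow> bool) \<Rightarrow> fm" where
  "diagram N P = conjs (map (\<lambda>(i, j). Conj (if i = j then Eq i j else Neg (Eq i j))
     (if P i j then Adj i j else Neg (Adj i j))) (List.product [0..<N] [0..<N]))"

lemma sat_diagram: "sat E s (diagram N P) \<longleftrightarrow> induced_embedding {..<N} P E s"
proof -
  have "sat E s (diagram N P) \<longleftrightarrow>
      (\<forall>i<N. \<forall>j<N. (s i = s j \<longleftrightarrow> i = j) \<and> (E (s i) (s j) \<longleftrightarrow> P i j))"
  proof -
    have "sat E s (Conj (if i = j then Eq i j else Neg (Eq i j))
        (if P i j then Adj i j else Neg (Adj i j))) \<longleftrightarrow>
      (s i = s j \<longleftrightarrow> i = j) \<and> (E (s i) (s j) \<longleftrightarrow> P i j)" for i j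
      by simp
    then show ?thesis unfolding diagram_def by (auto simp del: sat.simps)
  qed
  then show ?thesis unfolding induced_embedding_def inj_on_def by blast
qed

lemma K_free_graph_transfer:
  assumes models: "models E (complete_theory G)" and G: "K_free_graph n UNIV G"
  shows "K_free_graph n UNIV E"
proof -
  have "sat G s (Neg (Conj (Adj 0 1) (Neg (Adj 1 0))))" for s
    using G unfolding K_free_graph_def by auto
  then have "sat E s (Neg (Conj (Adj 0 1) (Neg (Adj 1 0))))" for s
    by (rule models_transfer[OF models])
  from this[of "\<lambda>i. if i = 0 then x else y" for x y] have sym: "E x y \<Longrightarrow> E y x" for x y by simp
  have "sat G s (Neg (Adj 0 0))" for s
    using G unfolding K_free_graph_def by auto
  then have "sat E s (Neg (Adj 0 0))" for s
    by (rule models_transfer[OF models])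
  from this[of "\<lambda>_. x" for x] have irrefl: "\<not> E x x" for x by simp
  \<comment> \<open>\<open>K\<^sub>n\<close>-freeness becomes one formula: a complete graph on
    \<open>n\<close> vertices is an embedded copy of \<open>{..<n}\<close> with edge relation
    \<open>(\<noteq>)\<close>.\<close>
  have "\<not> induced_embedding {..<n} (\<noteq>) G s" for s
  proof
    assume s: "induced_embedding {..<n} (\<noteq>) G s"
    then have "card (s ` {..<n}) = n" "pairwise G (s ` {..<n})"
      unfolding induced_embedding_def pairwise_def by (auto simp: card_image)
    then show False using G unfolding K_free_graph_def by blast
  qed
  then have "sat G s (Neg (diagram n (\<noteq>)))" for s by (simp add: sat_diagram)
  then have "sat E s (Neg (diagram n (\<noteq>)))" for s
    by (rule models_transfer[OF models])
  then have no: "\<not> induced_embedding {..<n} (\<noteq>) E s" for s by (simp add: sat_diagram)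
  have False if X: "finite X" "card X = n" "pairwise E X" for X
  proof -
    obtain h where h: "bij_betw h {..<n} X"
      using ex_bij_betw_nat_finite[OF X(1)] X(2) by (auto simp: atLeast0LessThan)
    then have "induced_embedding {..<n} (\<noteq>) E h"
      using X(3) irrefl unfolding induced_embedding_def bij_betw_def pairwise_def
      by (auto dest: inj_onD)
    then show False using no by blast
  qed
  then show ?thesis unfolding K_free_graph_def using sym irrefl by blast
qed

text \<open>In the generic graph the new vertex exists because universality embeds the enlarged
  finite graph and homogeneity moves that copy onto the given one. For a fixed finite graph this
  says that every realization of the smaller diagram extends to one of the larger, which is
  first-order and so passes to \<open>E\<close>.\<close>

lemma extension_property_transfer:
  assumes models: "models E (complete_theory G)" and G: "henson_graph n G"
    and F: "finite F" "U \<subseteq> F" and U: "\<And>Q. Q \<subseteq> U \<Longrightarrow> card Q = n - 1 \<Longrightarrow> \<not> pairwise E Q"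
    and n: "n \<ge> 1"
  shows "\<exists>a. a \<notin> F \<and> (\<forall>x\<in>F. E a x \<longleftrightarrow> x \<in> U)"
proof -
  have kfG: "K_free_graph n UNIV G"
    and embeds: "\<And>(V :: nat set) F. \<lbrakk>finite V; K_free_graph n V F\<rbrakk> \<Longrightarrow> \<exists>f. induced_embedding V F G f"
    and homogeneous: "\<And>S f. \<lbrakk>finite S; induced_embedding S G G f\<rbrakk> \<Longrightarrow>
      \<exists>g. induced_embedding UNIV G G g \<and> surj g \<and> (\<forall>x\<in>S. g x = f x)"
    using G unfolding henson_graph_def by simp_all
  have kf: "K_free_graph n UNIV E" using K_free_graph_transfer[OF models kfG] .
  define N where "N = card F"
  obtain h where h: "bij_betw h {..<N} F"
    using ex_bij_betw_nat_finite[OF F(1)] by (auto simp: atLeast0LessThan N_def)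
  then have inj: "inj_on h {..<N}" and im: "h ` {..<N} = F" by (auto simp: bij_betw_def)
  \<comment> \<open>The graph to be embedded: \<open>F\<close> copied to \<open>{..<N}\<close>, and
    a new vertex \<open>N\<close> joined to the copy of \<open>U\<close>.\<close>
  define P where "P i j \<longleftrightarrow> (if i < N \<and> j < N then E (h i) (h j) else if i < N then h i \<in> U
    else if j < N then h j \<in> U else False)" for i j :: nat
  have P: "K_free_graph n {..<Suc N} P"
    unfolding K_free_graph_def
  proof (intro conjI ballI impI notI)
    fix x y assume "P x y" then show "P y x"
      using kf unfolding P_def K_free_graph_def by (auto split: if_splits)
  next
    fix x assume "P x x" then show False
      using kf unfolding P_def K_free_graph_def by (auto split: if_splits)
  next
    assume "\<exists>X\<subseteq>{..<Suc N}. finite X \<and> card X = n \<and> pairwise P X"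
    then obtain X where X: "X \<subseteq> {..<Suc N}" "finite X" "card X = n" "pairwise P X" by blast
    define Y where "Y = X - {N}"
    have Y: "Y \<subseteq> {..<N}" using X(1) unfolding Y_def by (auto simp: less_Suc_eq)
    have cY: "card (h ` Y) = card Y" using inj Y card_image inj_on_subset by blast
    have pY: "pairwise E (h ` Y)"
    proof (intro pairwiseI)
      fix x y assume "x \<in> h ` Y" "y \<in> h ` Y" "x \<noteq> y"
      then obtain i j where ij: "i \<in> Y" "j \<in> Y" "x = h i" "y = h j" "i \<noteq> j" by blast
      then have "P i j" using X(4) unfolding Y_def pairwise_def by blast
      then show "E x y" using ij Y unfolding P_def by (auto split: if_splits)
    qed
    show False
    proof (cases "N \<in> X")
      case True
      then have "card (h ` Y) = n - 1" using cY X unfolding Y_def by simp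
      moreover have "h ` Y \<subseteq> U"
      proof
        fix z assume "z \<in> h ` Y"
        then obtain i where i: "i \<in> Y" "z = h i" by blast
        then have "P i N" using X(4) True unfolding Y_def pairwise_def by auto
        then show "z \<in> U" using i Y unfolding P_def by (auto split: if_splits)
      qed
      ultimately show False using U pY by blast
    next
      case False
      then have "card (h ` Y) = n" "finite (h ` Y)" using cY X unfolding Y_def by simp_all
      then show False using pY kf unfolding K_free_graph_def by blast
    qed
  qed
  have "sat G s (Neg (Conj (diagram N P) (Neg (Exi N (diagram (Suc N) P)))))" for s
  proof -
    have "\<exists>a. induced_embedding {..<Suc N} P G (s(N := a))" if s: "induced_embedding {..<N} P G s"
    proof -
      obtain f where f: "induced_embedding {..<Suc N} P G f"
        using embeds[OF _ P] by blast
      \<comment> \<open>\<open>k\<close> sends the embedded copy of \<open>{..<N}\<close> to its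
        given position \<open>s\<close>; the automorphism extending \<open>k\<close> then puts the
        new vertex at \<open>g (f N)\<close>.\<close>
      define k where "k = s \<circ> inv_into {..<N} f"
      have injf: "inj_on f {..<N}" using f unfolding induced_embedding_def
        by (auto intro: inj_on_subset)
      have k: "k (f i) = s i" if "i < N" for i
        unfolding k_def using that injf by simp
      have "induced_embedding (f ` {..<N}) G G k"
        using s f unfolding induced_embedding_def inj_on_def by (auto simp: k)
      then obtain g where g: "induced_embedding UNIV G G g" "\<forall>x\<in>f ` {..<N}. g x = k x"
        using homogeneous[of "f ` {..<N}" k] by blast
      have "g (f i) = (s(N := g (f N))) i" if "i < Suc N" for i
        using that g(2) k by (auto simp: less_Suc_eq)
      moreover have "induced_embedding {..<Suc N} P G (g \<circ> f)"
        using g(1) f unfolding induced_embedding_def by (auto intro!: comp_inj_on inj_on_subset[of g UNIV])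
      ultimately have "induced_embedding {..<Suc N} P G (s(N := g (f N)))"
        unfolding induced_embedding_def inj_on_def by (metis comp_apply lessThan_iff)
      then show ?thesis by blast
    qed
    then show ?thesis by (simp add: sat_diagram)
  qed
  then have "sat E h (Neg (Conj (diagram N P) (Neg (Exi N (diagram (Suc N) P)))))"
    by (rule models_transfer[OF models])
  moreover have "induced_embedding {..<N} P E h"
    unfolding induced_embedding_def P_def using inj by auto
  ultimately obtain a where a: "induced_embedding {..<Suc N} P E (h(N := a))"
    by (auto simp: sat_diagram)
  have "a \<noteq> h i \<and> (E a (h i) \<longleftrightarrow> h i \<in> U)" if "i < N" for i
  proof -
    have "inj_on (h(N := a)) {..<Suc N}" "E ((h(N := a)) N) ((h(N := a)) i) \<longleftrightarrow> P N i"
      using a that unfolding induced_embedding_def by (blast, meson lessI lessThan_iff less_SucI)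
    then show ?thesis using that unfolding P_def inj_on_def
      by (metis fun_upd_apply lessI lessThan_iff less_SucI less_irrefl)
  qed
  then show ?thesis using im by blast
qed

section \<open>Quantifier elimination and saturation\<close>

locale generic_K_free_graph =
  fixes n :: nat and E :: "'a \<Rightarrow> 'a \<Rightarrow> bool"
  assumes n_pos: "n \<ge> 1"
    and K_free: "K_free_graph n UNIV E"
    and extension: "\<lbrakk>finite F; U \<subseteq> F; \<And>Q. \<lbrakk>Q \<subseteq> U; card Q = n - 1\<rbrakk> \<Longrightarrow> \<not> pairwise E Q\<rbrakk>
      \<Longrightarrow> \<exists>a. a \<notin> F \<and> (\<forall>x\<in>F. E a x \<longleftrightarrow> x \<in> U)"
begin

lemma E_sym: "E x y \<Longrightarrow> E y x"
  using K_free unfolding K_free_graph_def by blast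

lemma E_commute: "E x y \<longleftrightarrow> E y x"
  using E_sym by blast

lemma E_irrefl [simp]: "\<not> E x x"
  using K_free unfolding K_free_graph_def by blast

lemma no_clique: "\<lbrakk>finite X; card X = n\<rbrakk> \<Longrightarrow> \<not> pairwise E X"
  using K_free unfolding K_free_graph_def by blast

text \<open>Irreflexivity of \<open>E\<close> forces \<open>f\<close> to be injective on
  \<open>X\<close>, so the image still has \<open>n\<close> vertices.\<close>

lemma no_clique_image:
  assumes "finite X" "card X = n" "\<And>x y. \<lbrakk>x \<in> X; y \<in> X; x \<noteq> y\<rbrakk> \<Longrightarrow> E (f x) (f y)"
  shows False
proof -
  have "inj_on f X" using assms(3) by (metis E_irrefl inj_onI)
  then have "card (f ` X) = n" using assms(2) card_image by blast
  moreover have "pairwise E (f ` X)" using assms(3) unfolding pairwise_def by blast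
  ultimately show False using no_clique assms(1) by blast
qed

section \<open>Quantifier elimination by back and forth\<close>

text \<open>The tuples \<open>s\<close> and \<open>t\<close> have the same quantifier-free
  type.\<close>

definition same_atoms :: "'i set \<Rightarrow> ('i \<Rightarrow> 'a) \<Rightarrow> ('i \<Rightarrow> 'a) \<Rightarrow> bool" where
  "same_atoms I s t \<longleftrightarrow> (\<forall>i\<in>I. \<forall>j\<in>I. (s i = s j \<longleftrightarrow> t i = t j) \<and> (E (s i) (s j) \<longleftrightarrow> E (t i) (t j)))"

lemma same_atoms_sym: "same_atoms I s t \<Longrightarrow> same_atoms I t s"
  unfolding same_atoms_def by blast

text \<open>The back-and-forth step. If \<open>a\<close> is new, \<open>b\<close> needs the
  corresponding neighbours among the \<open>t j\<close>; a complete graph on \<open>n - 1\<close> of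
  them would correspond, on the side of \<open>s\<close>, to a \<open>K\<^sub>n\<close> containing
  \<open>a\<close>, so the extension axiom applies.\<close>

lemma same_atoms_extend:
  assumes same: "same_atoms (I - {i}) s t" and fin: "finite I"
  shows "\<exists>b. same_atoms I (s(i := a)) (t(i := b))"
proof (cases "a \<in> s ` (I - {i})")
  case True
  then obtain j where j: "j \<in> I - {i}" "a = s j" by blast
  have "same_atoms I (s(i := a)) (t(i := t j))"
    using same j unfolding same_atoms_def by simp
  then show ?thesis by blast
next
  case False
  define J where "J = I - {i}"
  define U where "U = t ` {j \<in> J. E a (s j)}"
  have "\<not> pairwise E Q" if Q: "Q \<subseteq> U" "card Q = n - 1" for Q
  proof
    assume pw: "pairwise E Q"
    have "finite U" unfolding U_def J_def using fin by auto
    with Q(1) have finQ: "finite Q" using finite_subset by blast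
    have "\<forall>q\<in>Q. \<exists>j. j \<in> J \<and> E a (s j) \<and> t j = q" using Q(1) unfolding U_def by blast
    then obtain k where k: "\<And>q. q \<in> Q \<Longrightarrow> k q \<in> J \<and> E a (s (k q)) \<and> t (k q) = q" by metis
    \<comment> \<open>\<open>None\<close> stands for \<open>a\<close>, and \<open>Some q\<close> for
      the vertex on the side of \<open>s\<close> that corresponds to \<open>q\<close>.\<close>
    define f where "f x = (case x of None \<Rightarrow> a | Some q \<Rightarrow> s (k q))" for x
    have "E (s (k p)) (s (k q))" if "p \<in> Q" "q \<in> Q" "p \<noteq> q" for p q
      using k that pw same unfolding pairwise_def same_atoms_def J_def by metis
    then have "E (f x) (f y)" if "x \<in> insert None (Some ` Q)" "y \<in> insert None (Some ` Q)" "x \<noteq> y" for x y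
      using that k unfolding f_def by (auto intro: E_sym)
    moreover have "card (insert None (Some ` Q)) = n" "finite (insert None (Some ` Q))"
      using finQ Q(2) n_pos by (auto simp: card_image card_insert_if)
    ultimately show False using no_clique_image by blast
  qed
  then obtain b where b: "b \<notin> t ` J" "\<forall>x\<in>t ` J. E b x \<longleftrightarrow> x \<in> U"
    using extension[of "t ` J" U] fin unfolding U_def J_def by blast
  have "E a (s j) \<longleftrightarrow> E b (t j)" if "j \<in> J" for j
  proof -
    have "t j \<in> U \<longleftrightarrow> E a (s j)"
      using that same unfolding U_def same_atoms_def J_def image_iff by (metis (mono_tags, lifting) mem_Collect_eq)
    then show ?thesis using b that by blast
  qed
  then have "same_atoms I (s(i := a)) (t(i := b))"
    using same b(1) False unfolding same_atoms_def J_def by (auto intro: E_sym)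
  then show ?thesis by blast
qed

text \<open>Quantifier elimination in semantic form; the existential quantifier is handled by the
  back-and-forth step.\<close>

lemma sat_iff_if_same_atoms:
  "same_atoms (fv \<phi>) s t \<Longrightarrow> sat E s \<phi> \<longleftrightarrow> sat E t \<phi>"
proof (induction \<phi> arbitrary: s t)
  case (Exi i \<phi>)
  have "\<exists>b. sat E (t'(i := b)) \<phi>"
    if same: "same_atoms (fv \<phi> - {i}) s' t'" and a: "sat E (s'(i := a)) \<phi>" for s' t' a
    using same_atoms_extend[OF same finite_fv] a Exi.IH by blast
  then show ?case using Exi.prems same_atoms_sym by (metis fv.simps(5) sat.simps(5))
next
  case (Conj \<phi> \<psi>)
  then have "same_atoms (fv \<phi>) s t" "same_atoms (fv \<psi>) s t" unfolding same_atoms_def by auto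
  then show ?case using Conj.IH by simp
qed (auto simp: same_atoms_def)

section \<open>Types and their atomic formulas\<close>

lemma holds_subst_params: "holds E r (subst_params b (\<phi>, \<sigma>)) \<longleftrightarrow> sat E (case_sum r b \<circ> \<sigma>) \<phi>"
proof -
  have "case_sum r id \<circ> (map_sum id b \<circ> \<sigma>) = case_sum r b \<circ> \<sigma>"
    by (rule ext) (simp add: map_sum_def split: sum.split)
  then show ?thesis unfolding holds_def subst_params_def by simp
qed

lemma sat_iff_if_same_atoms_formulas:
  assumes "(\<phi>, \<sigma>) \<in> formulas X D" "same_atoms (X <+> D) s t"
  shows "sat E (s \<circ> \<sigma>) \<phi> \<longleftrightarrow> sat E (t \<circ> \<sigma>) \<phi>"
  using assms by (intro sat_iff_if_same_atoms) (auto simp: formulas_def same_atoms_def subset_iff)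

text \<open>By quantifier elimination, realizing a copy of a type reduces to matching equalities and
  edges, a condition on graphs alone.\<close>

lemma realizes_tp:
  assumes "same_atoms (X <+> D) (case_sum a id) (case_sum r b)"
  shows "realizes E r (subst_params b ` tp E a X D)"
  using sat_iff_if_same_atoms_formulas[OF _ assms]
  unfolding realizes_def tp_def by (auto simp: holds_subst_params) (simp add: holds_def)

lemma subst_params_id: "subst_params id = (\<lambda>\<psi>. \<psi>)"
  unfolding subst_params_def by (auto simp: map_sum.id)

lemma tp_subset:
  assumes "same_atoms (X <+> D) (case_sum a id) (case_sum r id)" "D \<subseteq> D'"
  shows "tp E a X D \<subseteq> tp E r X D'"
proof -
  have "tp E a X D \<subseteq> formulas X D'"
    using assms(2) unfolding tp_def formulas_def by (auto 0 3 simp: subset_iff)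
  then show ?thesis using realizes_tp[OF assms(1)]
    unfolding subst_params_id realizes_def by (auto simp: tp_def)
qed

lemma tp_eq:
  assumes "same_atoms (X <+> D) (case_sum a id) (case_sum r id)"
  shows "tp E a X D = tp E r X D"
  using tp_subset[OF assms] tp_subset[OF same_atoms_sym[OF assms]] by blast

lemma same_atoms_if_tp_eq:
  assumes "tp E a X D = tp E r X D"
  shows "same_atoms (X <+> D) (case_sum a id) (case_sum r id)"
  unfolding same_atoms_def
proof (intro ballI)
  fix u v assume uv: "u \<in> X <+> D" "v \<in> X <+> D"
  \<comment> \<open>Variable \<open>0\<close> stands for \<open>u\<close> and variable
    \<open>1\<close> for \<open>v\<close>, so \<open>Eq 0 1\<close> and \<open>Adj 0 1\<close>
    express the two atoms.\<close>
  define \<sigma> :: "nat \<Rightarrow> 'b + 'a" where "\<sigma> i = (if i = 0 then u else v)" for i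
  have "(\<phi>, \<sigma>) \<in> tp E a X D \<longleftrightarrow> (\<phi>, \<sigma>) \<in> tp E r X D" for \<phi> using assms by simp
  moreover have "(\<phi>, \<sigma>) \<in> formulas X D" for \<phi>
    unfolding formulas_def \<sigma>_def using uv by auto
  ultimately have "sat E (case_sum a id \<circ> \<sigma>) \<phi> \<longleftrightarrow> sat E (case_sum r id \<circ> \<sigma>) \<phi>" for \<phi>
    unfolding tp_def holds_def by auto
  from this[of "Eq 0 1"] this[of "Adj 0 1"]
  show "(case_sum a id u = case_sum a id v \<longleftrightarrow> case_sum r id u = case_sum r id v) \<and>
      (E (case_sum a id u) (case_sum a id v) \<longleftrightarrow> E (case_sum r id u) (case_sum r id v))"
    by (simp add: \<sigma>_def)
qed

lemma consistent_if_realizes: "realizes E r p \<Longrightarrow> consistent E p"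
  unfolding consistent_def realizes_def by blast

text \<open>Consistency realizes only finite sets of formulas, hence the finite \<open>P\<close>:
  finitely many positive atoms, each read in its own copy \<open>bs l\<close>, get one common
  realization \<open>r\<close>.\<close>

lemma consistent_tp_atoms:
  assumes cons: "consistent E (\<Union>l. subst_params (bs l) ` tp E a X D)"
    and fin: "finite P" and P: "\<And>l u v. (l, u, v) \<in> P \<Longrightarrow> u \<in> X <+> D \<and> v \<in> X <+> D"
  shows "\<exists>r. \<forall>(l, u, v)\<in>P.
    (case_sum a id u = case_sum a id v \<longrightarrow> case_sum r (bs l) u = case_sum r (bs l) v) \<and>
    (E (case_sum a id u) (case_sum a id v) \<longrightarrow> E (case_sum r (bs l) u) (case_sum r (bs l) v))"
proof -
  define \<sigma> :: "'b + 'a \<Rightarrow> 'b + 'a \<Rightarrow> nat \<Rightarrow> 'b + 'a" where "\<sigma> u v i = (if i = 0 then u else v)" for u v i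
  define \<Phi> where "\<Phi> = (\<lambda>(l, u, v). {subst_params (bs l) (\<phi>, \<sigma> u v) | \<phi>.
    \<phi> \<in> {Eq 0 1, Adj 0 1} \<and> holds E a (\<phi>, \<sigma> u v)})"
  have "(\<phi>, \<sigma> u v) \<in> formulas X D" if "(l, u, v) \<in> P" for l u v \<phi>
    unfolding formulas_def \<sigma>_def using P[OF that] by auto
  then have "\<Union>(\<Phi> ` P) \<subseteq> (\<Union>l. subst_params (bs l) ` tp E a X D)"
    unfolding \<Phi>_def tp_def by fast
  moreover have "finite (\<Union>(\<Phi> ` P))" using fin unfolding \<Phi>_def by auto
  ultimately obtain r where r: "realizes E r (\<Union>(\<Phi> ` P))"
    using cons unfolding consistent_def by meson
  have *: "sat E (case_sum r (bs l) \<circ> \<sigma> u v) \<phi>" if "(l, u, v) \<in> P" "\<phi> \<in> {Eq 0 1, Adj 0 1}"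
    "holds E a (\<phi>, \<sigma> u v)" for l u v \<phi>
  proof -
    have "subst_params (bs l) (\<phi>, \<sigma> u v) \<in> \<Phi> (l, u, v)" unfolding \<Phi>_def using that(2,3) by auto
    then have "holds E r (subst_params (bs l) (\<phi>, \<sigma> u v))"
      using r that(1) unfolding realizes_def by blast
    then show ?thesis by (simp only: holds_subst_params)
  qed
  have "(case_sum a id u = case_sum a id v \<longrightarrow> case_sum r (bs l) u = case_sum r (bs l) v) \<and>
    (E (case_sum a id u) (case_sum a id v) \<longrightarrow> E (case_sum r (bs l) u) (case_sum r (bs l) v))"
    if "(l, u, v) \<in> P" for l u v
    using *[OF that, of "Eq 0 1"] *[OF that, of "Adj 0 1"] by (simp add: holds_def \<sigma>_def)
  then show ?thesis by blast
qed

lemma complete_type_tp: "complete_type E X D (tp E a X D)"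
  unfolding complete_type_def
proof (intro conjI)
  show "consistent E (tp E a X D)"
    by (rule consistent_if_realizes[of a]) (simp add: realizes_def tp_def)
  show "\<forall>(\<phi>, \<sigma>)\<in>formulas X D. (\<phi>, \<sigma>) \<in> tp E a X D \<or> (Neg \<phi>, \<sigma>) \<in> tp E a X D"
    by (auto simp: tp_def formulas_def holds_def)
qed (auto simp: tp_def)

end

locale saturated_generic_K_free_graph = generic_K_free_graph n E for n :: nat and E :: "'a \<Rightarrow> 'a \<Rightarrow> bool" +
  fixes \<kappa> :: "'k rel"
  assumes Card_order: "Card_order \<kappa>" and uncountable: "natLeq <o \<kappa>" and saturated: "saturated \<kappa> E"
begin

section \<open>Cardinal arithmetic of small sets\<close>

lemma infinite_Field: "\<not> finite (Field \<kappa>)"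
  using Card_order uncountable
  by (meson cinfinite_def cinfinite_mono natLeq_cinfinite ordLess_imp_ordLeq)

lemma small_subset: "small \<kappa> V \<Longrightarrow> U \<subseteq> V \<Longrightarrow> small \<kappa> U"
  unfolding small_def using card_of_mono1 ordLeq_ordLess_trans by blast

lemma small_image: "small \<kappa> V \<Longrightarrow> small \<kappa> (f ` V)"
  unfolding small_def using card_of_image ordLeq_ordLess_trans by blast

lemma small_image_inj: "small \<kappa> (f ` V) \<Longrightarrow> inj_on f V \<Longrightarrow> small \<kappa> V"
  using small_image[of "f ` V" "inv_into V f"] by simp

lemma small_Un: "small \<kappa> U \<Longrightarrow> small \<kappa> V \<Longrightarrow> small \<kappa> (U \<union> V)"
  unfolding small_def using card_of_Un_ordLess_infinite_Field infinite_Field Card_order by blast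

lemma small_Times_nat:
  assumes "small \<kappa> V"
  shows "small \<kappa> (V \<times> (UNIV :: nat set))"
proof -
  \<comment> \<open>The disjoint union with the natural numbers is small and infinite, so its square
    has the same cardinality and covers \<open>V \<times> UNIV\<close> by projection.\<close>
  let ?W = "Inl ` V \<union> Inr ` (UNIV :: nat set)"
  have "small \<kappa> (UNIV :: nat set)"
    unfolding small_def using card_of_nat uncountable ordIso_ordLess_trans by blast
  then have W: "small \<kappa> ?W"
    by (intro small_Un small_image assms)
  have "\<not> finite ?W" by (simp add: finite_image_iff)
  then have "small \<kappa> (?W \<times> ?W)"
    using W unfolding small_def by (metis card_of_Times_same_infinite ordIso_ordLess_trans)
  then have "small \<kappa> (map_prod projl projr ` (?W \<times> ?W))"
    by (rule small_image)
  moreover have "V \<times> UNIV \<subseteq> map_prod projl projr ` (?W \<times> ?W)"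
  proof
    fix x :: "'b \<times> nat" assume "x \<in> V \<times> UNIV"
    then have "(Inl (fst x), Inr (snd x)) \<in> ?W \<times> ?W" by auto
    then show "x \<in> map_prod projl projr ` (?W \<times> ?W)" by (rule rev_image_eqI) simp
  qed
  ultimately show ?thesis by (rule small_subset)
qed

lemma small_UN_nat: "small \<kappa> D \<Longrightarrow> small \<kappa> (\<Union>l::nat. bs l ` D)"
proof -
  assume "small \<kappa> D"
  moreover have "(\<Union>l. bs l ` D) = (\<lambda>(d, l). bs l d) ` (D \<times> (UNIV :: nat set))" by auto
  ultimately show ?thesis using small_image small_Times_nat by metis
qed

text \<open>The type to be realized consists of the formulas true of every vertex that has the prescribed
  neighbourhood on the parameters of the formula; completeness of this type is quantifier
  elimination.\<close>

lemma extension_small: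
  assumes D: "small \<kappa> D" and U: "U \<subseteq> D"
    and K: "\<And>Q. \<lbrakk>finite Q; Q \<subseteq> U; card Q = n - 1\<rbrakk> \<Longrightarrow> \<not> pairwise E Q"
  shows "\<exists>a. a \<notin> D \<and> (\<forall>x\<in>D. E a x \<longleftrightarrow> x \<in> U)"
proof -
  define gen where "gen S a \<longleftrightarrow> a \<notin> S \<and> (\<forall>d\<in>S. E a d \<longleftrightarrow> d \<in> U)" for S a
  define params :: "(unit, 'a) formula \<Rightarrow> 'a set" where "params = (\<lambda>(\<phi>, \<sigma>). Inr -` \<sigma> ` fv \<phi>)"
  define p where "p = {\<psi> \<in> formulas UNIV D. \<exists>a. gen (params \<psi>) a \<and> holds E (\<lambda>_. a) \<psi>}"
  have ex_gen: "\<exists>a. gen S a" if "finite S" for S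
  proof -
    have "\<not> pairwise E Q" if "Q \<subseteq> S \<inter> U" "card Q = n - 1" for Q
      using K that \<open>finite S\<close> by (meson finite_Int finite_subset le_inf_iff)
    then show ?thesis using extension[of S "S \<inter> U"] that unfolding gen_def by auto
  qed
  have fin: "finite (params \<psi>)" for \<psi>
    unfolding params_def by (cases \<psi>) (simp add: finite_fv finite_vimageI)
  have agree: "holds E (\<lambda>_. a) \<psi> \<longleftrightarrow> holds E (\<lambda>_. b) \<psi>"
    if gen: "gen (params \<psi>) a" "gen (params \<psi>) b" for a b \<psi>
  proof -
    obtain \<phi> \<sigma> where \<psi>: "\<psi> = (\<phi>, \<sigma>)" by force
    have *: "\<sigma> i = Inl () \<or> (\<exists>d\<in>params \<psi>. \<sigma> i = Inr d)" if "i \<in> fv \<phi>" for i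
    proof (cases "\<sigma> i")
      case (Inr d)
      then have "d \<in> params \<psi>" unfolding params_def \<psi> using that by (auto simp: image_iff) metis
      then show ?thesis using Inr by blast
    qed auto
    have "same_atoms (fv \<phi>) (case_sum (\<lambda>_. a) id \<circ> \<sigma>) (case_sum (\<lambda>_. b) id \<circ> \<sigma>)"
      unfolding same_atoms_def
    proof (intro ballI)
      fix i j assume "i \<in> fv \<phi>" "j \<in> fv \<phi>"
      from *[OF this(1)] *[OF this(2)]
      show "((case_sum (\<lambda>_. a) id \<circ> \<sigma>) i = (case_sum (\<lambda>_. a) id \<circ> \<sigma>) j \<longleftrightarrow>
          (case_sum (\<lambda>_. b) id \<circ> \<sigma>) i = (case_sum (\<lambda>_. b) id \<circ> \<sigma>) j) \<and>
        (E ((case_sum (\<lambda>_. a) id \<circ> \<sigma>) i) ((case_sum (\<lambda>_. a) id \<circ> \<sigma>) j) \<longleftrightarrow>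
          E ((case_sum (\<lambda>_. b) id \<circ> \<sigma>) i) ((case_sum (\<lambda>_. b) id \<circ> \<sigma>) j))"
        using gen E_sym unfolding gen_def by (elim disjE bexE) (simp, auto)
    qed
    then show ?thesis unfolding \<psi> holds_def by (auto dest: sat_iff_if_same_atoms)
  qed
  have gen_mono: "gen S a \<Longrightarrow> S' \<subseteq> S \<Longrightarrow> gen S' a" for S S' a
    unfolding gen_def by blast
  have "complete_type E UNIV D p"
    unfolding complete_type_def
  proof (intro conjI)
    show "consistent E p"
      unfolding consistent_def
    proof (intro allI impI)
      fix F assume F: "F \<subseteq> p" "finite F"
      obtain a where a: "gen (\<Union>(params ` F)) a" using ex_gen fin F(2) by blast
      have "holds E (\<lambda>_. a) \<psi>" if "\<psi> \<in> F" for \<psi>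
      proof -
        have "gen (params \<psi>) a" using gen_mono[OF a] that by blast
        then show ?thesis using agree that F(1) unfolding p_def by blast
      qed
      then show "\<exists>a. realizes E a F" unfolding realizes_def by blast
    qed
    show "\<forall>(\<phi>, \<sigma>)\<in>formulas UNIV D. (\<phi>, \<sigma>) \<in> p \<or> (Neg \<phi>, \<sigma>) \<in> p"
    proof (intro ballI, clarify)
      fix \<phi> \<sigma> assume f: "(\<phi>, \<sigma>) \<in> formulas UNIV D" "(Neg \<phi>, \<sigma>) \<notin> p"
      obtain a where a: "gen (params (\<phi>, \<sigma>)) a" using ex_gen fin by blast
      have "params (Neg \<phi>, \<sigma>) = params (\<phi>, \<sigma>)" "(Neg \<phi>, \<sigma>) \<in> formulas UNIV D"
        using f(1) unfolding params_def formulas_def by auto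
      then have "\<not> holds E (\<lambda>_. a) (Neg \<phi>, \<sigma>)" using f(2) a unfolding p_def by auto
      then show "(\<phi>, \<sigma>) \<in> p" using f(1) a unfolding p_def holds_def by auto
    qed
  qed (auto simp: p_def)
  then obtain r where r: "realizes E r p"
    using saturated D unfolding saturated_def by blast
  have "r () \<noteq> d \<and> (E (r ()) d \<longleftrightarrow> d \<in> U)" if d: "d \<in> D" for d
  proof -
    define \<sigma> :: "nat \<Rightarrow> unit + 'a" where "\<sigma> i = (if i = 0 then Inl () else Inr d)" for i
    define \<phi> where "\<phi> = Conj (Neg (Eq 0 1)) (if d \<in> U then Adj 0 1 else Neg (Adj 0 1))"
    have f: "(\<phi>, \<sigma>) \<in> formulas UNIV D" unfolding formulas_def \<sigma>_def using d by auto
    have "d \<in> params (\<phi>, \<sigma>)" unfolding params_def \<phi>_def \<sigma>_def by auto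
    then have "holds E (\<lambda>_. a) (\<phi>, \<sigma>)" if "gen (params (\<phi>, \<sigma>)) a" for a
      using that unfolding gen_def holds_def \<phi>_def \<sigma>_def by auto
    then have "(\<phi>, \<sigma>) \<in> p" using f ex_gen[OF fin] unfolding p_def by blast
    then have "holds E r (\<phi>, \<sigma>)" using r unfolding realizes_def by blast
    then show ?thesis unfolding holds_def \<phi>_def \<sigma>_def by (auto split: if_splits)
  qed
  then show ?thesis by blast
qed

section \<open>Embedding and amalgamating small graphs\<close>

text \<open>Zorn's lemma on partial embeddings. A maximal one is total: for a vertex
  \<open>v\<close> left out, \<open>extension_small\<close> gives an image, because a complete graph
  on \<open>n - 1\<close> of its required neighbours would pull back to a \<open>K\<^sub>n\<close>
  in \<open>F\<close> containing \<open>v\<close>.\<close>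

lemma embed_small_K_free_graph:
  assumes V: "K_free_graph n V F" "small \<kappa> V" and S: "S \<subseteq> V" "induced_embedding S F E f"
  shows "\<exists>g. induced_embedding V F E g \<and> (\<forall>x\<in>S. g x = f x)"
proof -
  \<comment> \<open>Partial embeddings are represented by their graphs, so that chains are bounded
    by their unions. The equivalence of \<open>fst p = fst q\<close> and
    \<open>snd p = snd q\<close> says single-valued and injective at once.\<close>
  define good where "good M \<longleftrightarrow> (\<lambda>x. (x, f x)) ` S \<subseteq> M \<and> fst ` M \<subseteq> V \<and>
    (\<forall>p\<in>M. \<forall>q\<in>M. (fst p = fst q \<longleftrightarrow> snd p = snd q) \<and> (F (fst p) (fst q) \<longleftrightarrow> E (snd p) (snd q)))" for M
  have "\<exists>M\<in>Collect good. \<forall>X\<in>Collect good. M \<subseteq> X \<longrightarrow> X = M"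
  proof (rule subset_Zorn_nonempty)
    have "good ((\<lambda>x. (x, f x)) ` S)"
      using S unfolding good_def induced_embedding_def by (auto dest: inj_onD)
    then show "Collect good \<noteq> {}" by blast
  next
    fix \<C> assume \<C>: "\<C> \<noteq> {}" "subset.chain (Collect good) \<C>"
    have g: "good M" if "M \<in> \<C>" for M using that \<C>(2) unfolding subset_chain_def by blast
    have "\<exists>M\<in>\<C>. p \<in> M \<and> q \<in> M" if "p \<in> \<Union>\<C>" "q \<in> \<Union>\<C>" for p q
      using that \<C>(2) unfolding subset_chain_def by (meson UnionE subsetD)
    then have "(fst p = fst q \<longleftrightarrow> snd p = snd q) \<and> (F (fst p) (fst q) \<longleftrightarrow> E (snd p) (snd q))"
      if "p \<in> \<Union>\<C>" "q \<in> \<Union>\<C>" for p q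
      using that g unfolding good_def by meson
    moreover have "(\<lambda>x. (x, f x)) ` S \<subseteq> \<Union>\<C>" using \<C>(1) g unfolding good_def by blast
    moreover have "fst ` \<Union>\<C> \<subseteq> V" using g unfolding good_def by blast
    ultimately have "good (\<Union>\<C>)" unfolding good_def by blast
    then show "\<Union>\<C> \<in> Collect good" by blast
  qed
  then obtain M where M: "good M" and max: "\<And>X. good X \<Longrightarrow> M \<subseteq> X \<Longrightarrow> X = M" by blast
  have fM: "fst ` M \<subseteq> V" and SM: "(\<lambda>x. (x, f x)) ` S \<subseteq> M"
    and M_eq: "\<And>p q. \<lbrakk>p \<in> M; q \<in> M\<rbrakk> \<Longrightarrow> fst p = fst q \<longleftrightarrow> snd p = snd q"
    and M_E: "\<And>p q. \<lbrakk>p \<in> M; q \<in> M\<rbrakk> \<Longrightarrow> F (fst p) (fst q) \<longleftrightarrow> E (snd p) (snd q)"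
    using M unfolding good_def by simp_all
  have total: "fst ` M = V"
  proof (rule ccontr)
    assume "fst ` M \<noteq> V"
    then obtain v where v: "v \<in> V" "v \<notin> fst ` M" using fM by blast
    have symF: "F x y \<Longrightarrow> F y x" if "x \<in> V" "y \<in> V" for x y
      using V(1) that unfolding K_free_graph_def by blast
    have irrF: "\<not> F x x" if "x \<in> V" for x
      using V(1) that unfolding K_free_graph_def by blast
    \<comment> \<open>\<open>M\<close> is in bijection with its domain, a subset of
      \<open>V\<close>; hence its range is small and \<open>extension_small\<close> applies over
      it.\<close>
    have "inj_on fst M" using M_eq by (meson inj_onI prod_eqI)
    then have "small \<kappa> (snd ` M)"
      using small_image small_image_inj small_subset[OF V(2) fM] by blast
    define U where "U = snd ` {q \<in> M. F v (fst q)}"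
    have "\<not> pairwise E Q" if Q: "finite Q" "Q \<subseteq> U" "card Q = n - 1" for Q
    proof
      assume pw: "pairwise E Q"
      have "\<forall>b\<in>Q. \<exists>q. q \<in> M \<and> F v (fst q) \<and> snd q = b" using Q(2) unfolding U_def by blast
      then obtain k where k: "\<And>b. b \<in> Q \<Longrightarrow> k b \<in> M \<and> F v (fst (k b)) \<and> snd (k b) = b" by metis
      have inj: "inj_on (fst \<circ> k) Q"
      proof (rule inj_onI)
        fix b c assume bc: "b \<in> Q" "c \<in> Q" "(fst \<circ> k) b = (fst \<circ> k) c"
        then show "b = c" using M_eq[of "k b" "k c"] k[of b] k[of c] by simp
      qed
      have "card (insert v ((fst \<circ> k) ` Q)) = n"
      proof -
        have "v \<notin> (fst \<circ> k) ` Q" using v k by auto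
        then show ?thesis using Q n_pos card_image[OF inj] by simp
      qed
      moreover have "pairwise F (insert v ((fst \<circ> k) ` Q))"
      proof -
        have "F (fst (k b)) (fst (k c))" if "b \<in> Q" "c \<in> Q" "b \<noteq> c" for b c
          using that k[of b] k[of c] M_E[of "k b" "k c"] pw unfolding pairwise_def by simp
        moreover have "F v (fst (k b)) \<and> F (fst (k b)) v" if "b \<in> Q" for b
          using k[OF that] symF v(1) fM by blast
        ultimately show ?thesis unfolding pairwise_insert by (auto simp: pairwise_def)
      qed
      moreover have "insert v ((fst \<circ> k) ` Q) \<subseteq> V" using v(1) k fM by auto
      ultimately show False using V(1) Q(1) unfolding K_free_graph_def
        by (metis finite_imageI finite_insert)
    qed
    then obtain a where a: "a \<notin> snd ` M" "\<forall>x\<in>snd ` M. E a x \<longleftrightarrow> x \<in> U"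
      using extension_small[OF \<open>small \<kappa> (snd ` M)\<close>, of U] unfolding U_def by blast
    have aE: "E a (snd q) \<longleftrightarrow> F v (fst q)" if "q \<in> M" for q
    proof -
      have "F v (fst q)" if "p \<in> M" "F v (fst p)" "snd q = snd p" for p
        using M_eq[OF \<open>q \<in> M\<close> that(1)] that by simp
      then have "snd q \<in> U \<longleftrightarrow> F v (fst q)" using that unfolding U_def by blast
      then show ?thesis using a(2) that by blast
    qed
    have "good (insert (v, a) M)"
      unfolding good_def
    proof (intro conjI ballI)
      fix p q assume pq: "p \<in> insert (v, a) M" "q \<in> insert (v, a) M"
      show "fst p = fst q \<longleftrightarrow> snd p = snd q"
      proof -
        have "fst r \<noteq> v" "snd r \<noteq> a" if "r \<in> M" for r using that v(2) a(1) by blast+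
        then show ?thesis using pq M_eq[of p q] by fastforce
      qed
      have Ea: "E (snd q) a \<longleftrightarrow> F (fst q) v" if "q \<in> M" for q
        using aE[OF that] E_sym symF v(1) fM that by blast
      show "F (fst p) (fst q) \<longleftrightarrow> E (snd p) (snd q)"
        using pq aE Ea M_E irrF[OF v(1)] by (elim insertE) simp_all
    qed (use SM fM v(1) in auto)
    then have "insert (v, a) M = M" using max by blast
    then show False using v(2) by force
  qed
  define g where "g x = snd (SOME q. q \<in> M \<and> fst q = x)" for x
  have g: "(x, g x) \<in> M" if "x \<in> V" for x
  proof -
    have "\<exists>q. q \<in> M \<and> fst q = x" using that total by blast
    from someI_ex[OF this] show ?thesis unfolding g_def by (metis prod.collapse)
  qed
  have "induced_embedding V F E g"
    unfolding induced_embedding_def inj_on_def using M_eq[OF g g] M_E[OF g g] by simp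
  moreover have "g x = f x" if "x \<in> S" for x
    using M_eq[OF g, of x "(x, f x)"] that SM S(1) by auto
  ultimately show ?thesis by blast
qed

text \<open>The abstract graph on \<open>W <+> S\<close> is embedded over \<open>S\<close>. A
  \<open>K\<^sub>n\<close> in it splits into \<open>P\<close> in \<open>W\<close> and
  \<open>Q\<close> in \<open>S\<close>; with \<open>P\<close> empty it would be a
  \<open>K\<^sub>n\<close> of \<open>E\<close>, so the hypothesis only has to exclude nonempty
  \<open>P\<close>.\<close>

lemma amalgam:
  assumes small: "small \<kappa> W" "small \<kappa> S"
    and K: "\<And>P Q. \<lbrakk>finite P; finite Q; P \<subseteq> W; Q \<subseteq> S; P \<noteq> {}; card P + card Q = n; pairwise E P;
      pairwise E Q; \<forall>p\<in>P. \<forall>q\<in>Q. N p q\<rbrakk> \<Longrightarrow> False"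
  shows "\<exists>g. inj_on g W \<and> g ` W \<inter> S = {} \<and> (\<forall>w\<in>W. \<forall>w'\<in>W. E (g w) (g w') \<longleftrightarrow> E w w') \<and>
    (\<forall>w\<in>W. \<forall>s\<in>S. E (g w) s \<longleftrightarrow> N w s)"
proof -
  define V where "V = W <+> S"
  define F where "F u v = (case u of
      Inl w \<Rightarrow> (case v of Inl w' \<Rightarrow> E w w' | Inr s \<Rightarrow> N w s)
    | Inr s \<Rightarrow> (case v of Inl w \<Rightarrow> N w s | Inr s' \<Rightarrow> E s s'))" for u v :: "'a + 'a"
  have "small \<kappa> V" unfolding V_def Plus_def using small small_image small_Un by blast
  have KV: "K_free_graph n V F"
    unfolding K_free_graph_def
  proof (intro conjI ballI impI notI)
    fix u v assume "F u v" then show "F v u"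
      unfolding F_def using E_sym by (auto split: sum.splits)
  next
    fix u assume "F u u" then show False
      unfolding F_def by (auto split: sum.splits)
  next
    assume "\<exists>Z\<subseteq>V. finite Z \<and> card Z = n \<and> pairwise F Z"
    then obtain Z where Z: "Z \<subseteq> V" "finite Z" "card Z = n" "pairwise F Z" by blast
    define P where "P = Inl -` Z"
    define Q where "Q = Inr -` Z"
    have ZPQ: "Z = P <+> Q"
    proof (intro set_eqI)
      fix u show "u \<in> Z \<longleftrightarrow> u \<in> P <+> Q" unfolding P_def Q_def by (cases u) auto
    qed
    have fin: "finite P" "finite Q" using Z(2) unfolding P_def Q_def by (simp_all add: finite_vimageI)
    have c: "card P + card Q = n" using Z(3) fin unfolding ZPQ by (simp add: card_Plus)
    have sub: "P \<subseteq> W" "Q \<subseteq> S" using Z(1) unfolding V_def P_def Q_def by auto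
    have Fuv: "F u v" if "u \<in> Z" "v \<in> Z" "u \<noteq> v" for u v using Z(4) that unfolding pairwise_def by blast
    have P: "pairwise E P" using Fuv[of "Inl _" "Inl _"] unfolding pairwise_def P_def F_def by auto
    have Q: "pairwise E Q" using Fuv[of "Inr _" "Inr _"] unfolding pairwise_def Q_def F_def by auto
    have PQ: "N p q" if "p \<in> P" "q \<in> Q" for p q
      using Fuv[of "Inl p" "Inr q"] that unfolding P_def Q_def F_def by auto
    have "P \<noteq> {}" using no_clique[OF fin(2)] Q c by auto
    then show False using K[OF fin sub _ c P Q] PQ by blast
  qed
  have emb: "induced_embedding (Inr ` S) F E (case_sum id id)"
    unfolding induced_embedding_def F_def by (auto simp: inj_on_def)
  have "Inr ` S \<subseteq> V" unfolding V_def by auto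
  from embed_small_K_free_graph[OF KV \<open>small \<kappa> V\<close> this emb]
  obtain g where g: "induced_embedding V F E g" "\<forall>x\<in>Inr ` S. g x = case_sum id id x" by blast
  have gS: "g (Inr s) = s" if "s \<in> S" for s using g(2) that by simp
  have gi: "g u = g v \<longleftrightarrow> u = v" "E (g u) (g v) \<longleftrightarrow> F u v" if "u \<in> W <+> S" "v \<in> W <+> S" for u v
    using g(1) that unfolding induced_embedding_def V_def by (auto dest: inj_onD)
  have "inj_on (g \<circ> Inl) W" unfolding inj_on_def using gi(1) by auto
  moreover have "(g \<circ> Inl) ` W \<inter> S = {}" using gi(1)[of "Inl _" "Inr _"] gS by fastforce
  moreover have "E ((g \<circ> Inl) w) ((g \<circ> Inl) w') \<longleftrightarrow> E w w'" if "w \<in> W" "w' \<in> W" for w w'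
    using gi(2)[of "Inl w" "Inl w'"] that unfolding F_def by auto
  moreover have "E ((g \<circ> Inl) w) s \<longleftrightarrow> N w s" if "w \<in> W" "s \<in> S" for w s
    using gi(2)[of "Inl w" "Inr s"] gS[OF that(2)] that unfolding F_def by auto
  ultimately show ?thesis by blast
qed

section \<open>Dividing and forking\<close>

lemma K_rel_mono:
  assumes "K_rel n E X Y" "X \<subseteq> X'" "X' \<inter> Y = {}"
  shows "K_rel n E X' Y"
proof -
  obtain Z where Z: "Z \<subseteq> X \<union> Y" "finite Z" "card Z = n" "Z \<inter> Y \<noteq> {}" "Z \<inter> X \<noteq> {}"
    "pairwise E (Z \<inter> Y)" "\<forall>x\<in>Z \<inter> X. \<forall>y\<in>Z \<inter> Y. E x y"
    using assms(1) unfolding K_rel_def by blast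
  have "Z \<inter> X' = Z \<inter> X" using Z(1) assms(2,3) by blast
  then show ?thesis unfolding K_rel_def using Z assms(2) by (intro exI[of _ Z]) auto
qed

section \<open>Atoms along an indiscernible sequence\<close>

lemma indiscernible_single:
  assumes ind: "indiscernible E C J bs" and "d \<in> J"
  shows "e \<in> J \<Longrightarrow> bs l d = bs l e \<longleftrightarrow> bs m d = bs m e"
    and "e \<in> J \<Longrightarrow> E (bs l d) (bs l e) \<longleftrightarrow> E (bs m d) (bs m e)"
    and "c \<in> C \<Longrightarrow> bs l d = c \<longleftrightarrow> bs m d = c"
    and "c \<in> C \<Longrightarrow> E (bs l d) c \<longleftrightarrow> E (bs m d) c"
proof -
  \<comment> \<open>On a one-element set every function is increasing, so indiscernibility compares
    any two single tuples over \<open>C\<close>.\<close>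
  have "strict_mono_on {..<Suc 0} (\<lambda>_. k)" for k :: nat by (auto simp: monotone_on_def)
  with ind have "tp E (\<lambda>(i, y). bs l y) ({..<Suc 0} \<times> J) C = tp E (\<lambda>(i, y). bs m y) ({..<Suc 0} \<times> J) C"
    unfolding indiscernible_def by blast
  from same_atoms_if_tp_eq[OF this]
  have *: "\<And>u v. \<lbrakk>u \<in> {..<Suc 0} \<times> J <+> C; v \<in> {..<Suc 0} \<times> J <+> C\<rbrakk> \<Longrightarrow>
    (case_sum (\<lambda>(i, y). bs l y) id u = case_sum (\<lambda>(i, y). bs l y) id v \<longleftrightarrow>
     case_sum (\<lambda>(i, y). bs m y) id u = case_sum (\<lambda>(i, y). bs m y) id v) \<and>
    (E (case_sum (\<lambda>(i, y). bs l y) id u) (case_sum (\<lambda>(i, y). bs l y) id v) \<longleftrightarrow>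
     E (case_sum (\<lambda>(i, y). bs m y) id u) (case_sum (\<lambda>(i, y). bs m y) id v))"
    unfolding same_atoms_def by blast
  show "e \<in> J \<Longrightarrow> bs l d = bs l e \<longleftrightarrow> bs m d = bs m e"
    and "e \<in> J \<Longrightarrow> E (bs l d) (bs l e) \<longleftrightarrow> E (bs m d) (bs m e)"
    using *[of "Inl (0, d)" "Inl (0, e)"] assms(2) by auto
  show "c \<in> C \<Longrightarrow> bs l d = c \<longleftrightarrow> bs m d = c"
    and "c \<in> C \<Longrightarrow> E (bs l d) c \<longleftrightarrow> E (bs m d) c"
    using *[of "Inl (0, d)" "Inr c"] assms(2) by auto
qed

lemma indiscernible_pair:
  assumes ind: "indiscernible E C J bs" and de: "d \<in> J" "e \<in> J" and lm: "l < m" "l' < m'"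
  shows "bs l d = bs m e \<longleftrightarrow> bs l' d = bs m' e"
    and "E (bs l d) (bs m e) \<longleftrightarrow> E (bs l' d) (bs m' e)"
proof -
  define f where "f l m i = (if i = 0 then l else m)" for l m i :: nat
  have "strict_mono_on {..<2} (f l m)" "strict_mono_on {..<2} (f l' m')"
    using lm unfolding f_def monotone_on_def by auto
  with ind have "tp E (\<lambda>(i, y). bs (f l m i) y) ({..<2} \<times> J) C =
      tp E (\<lambda>(i, y). bs (f l' m' i) y) ({..<2} \<times> J) C"
    unfolding indiscernible_def by blast
  from same_atoms_if_tp_eq[OF this, unfolded same_atoms_def, rule_format, of "Inl (0, d)" "Inl (1, e)"] de
  show "bs l d = bs m e \<longleftrightarrow> bs l' d = bs m' e"
    and "E (bs l d) (bs m e) \<longleftrightarrow> E (bs l' d) (bs m' e)"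
    by (simp_all add: f_def InlI)
qed

section \<open>From the combinatorial condition to independence\<close>

text \<open>The type is realized along the whole indiscernible sequence by amalgamating one new copy
  of the image of \<open>a\<close> with all copies of \<open>D\<close>. The work lies in showing
  that this creates no \<open>K\<^sub>n\<close>.\<close>

lemma not_divides:
  assumes A: "small \<kappa> A" and D: "small \<kappa> D" and CD: "C \<subseteq> D" and AD: "a ` A \<inter> D \<subseteq> C"
    and K: "\<And>Y. \<lbrakk>Y \<subseteq> D - C; K_rel n E Y (a ` A \<union> C)\<rbrakk> \<Longrightarrow> K_rel n E Y C"
  shows "\<not> divides E C (tp E a A D) D id"
proof
  assume "divides E C (tp E a A D) D id"
  then obtain bs where bs0: "\<And>d. d \<in> D \<Longrightarrow> bs 0 d = d" and ind: "indiscernible E C D bs"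
    and incons: "\<not> consistent E (\<Union>l. subst_params (bs l) ` tp E a A D)"
    unfolding divides_def by auto
  define W where "W = a ` A - C"
  define S where "S = (\<Union>l. bs l ` D)"
  \<comment> \<open>The new copy of \<open>w\<close> is to be joined to each copy of
    \<open>d\<close> exactly when \<open>w\<close> is joined to \<open>d\<close>;
    \<open>coord\<close> below makes this unambiguous.\<close>
  define N where "N w s \<longleftrightarrow> (\<exists>l. \<exists>d\<in>D. s = bs l d \<and> E w d)" for w s
  have WD: "W \<inter> D = {}" unfolding W_def using AD by blast
  have bsC: "bs l c = c" if "c \<in> C" for l c
    using indiscernible_single(3)[OF ind, of c c l 0] bs0 that CD by auto
  have bs_eq: "bs l d = bs l e \<longleftrightarrow> d = e" if "d \<in> D" "e \<in> D" for l d e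
    using indiscernible_single(1)[OF ind that, of l 0] bs0 that by simp
  have bs_E: "E (bs l d) (bs l e) \<longleftrightarrow> E d e" if "d \<in> D" "e \<in> D" for l d e
    using indiscernible_single(2)[OF ind that, of l 0] bs0 that by simp
  have bs_EC: "E (bs l d) c \<longleftrightarrow> E d c" if "d \<in> D" "c \<in> C" for l d c
    using indiscernible_single(4)[OF ind that, of l 0] bs0 that by simp
  have less: "d = e" if "d \<in> D" "e \<in> D" "bs l d = bs m e" "l < m" for d e l m
  proof -
    \<comment> \<open>By indiscernibility the coincidence occurs for all pairs of indices, whence
      \<open>bs 1 d = bs 2 e = bs 0 d = bs 1 e\<close> inside one tuple.\<close>
    have "bs 0 d = bs 1 e" "bs 0 d = bs 2 e" "bs 1 d = bs 2 e"
      using indiscernible_pair(1)[OF ind that(1,2,4)] that(3) by simp_all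
    then have "bs 1 d = bs 1 e" by simp
    then show ?thesis using bs_eq that by blast
  qed
  have coord: "d = e" if "d \<in> D" "e \<in> D" "bs l d = bs m e" for d e l m
    using less[OF that] less[OF that(2,1) that(3)[symmetric]] that bs_eq
    by (cases l m rule: linorder_cases) auto
  \<comment> \<open>Otherwise indiscernibility would make all copies of \<open>d\<close> pairwise
    adjacent.\<close>
  have less_nonadj: "\<not> E (bs l d) (bs m d)" if "d \<in> D" "l < m" for d l m
  proof
    assume "E (bs l d) (bs m d)"
    then have "E (bs i d) (bs j d)" if "i < j" for i j
      using indiscernible_pair(2)[OF ind \<open>d \<in> D\<close> \<open>d \<in> D\<close> \<open>l < m\<close> that] by blast
    then have "E (bs i d) (bs j d)" if "i \<noteq> j" for i j
      using that E_sym by (cases i j rule: linorder_cases) auto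
    then show False using no_clique_image[of "{..<n}" "\<lambda>i. bs i d"] by simp
  qed
  have nonadj: "\<not> E (bs l d) (bs m d)" if "d \<in> D" for d l m
    using less_nonadj[OF that] E_sym by (cases l m rule: linorder_cases) auto
  have no_K: False if fin: "finite P" "finite Q" and sub: "P \<subseteq> W" "Q \<subseteq> S"
    and ne: "P \<noteq> {}" and card: "card P + card Q = n" and P: "pairwise E P" and Q: "pairwise E Q" and PQ: "\<forall>p\<in>P. \<forall>q\<in>Q. N p q" for P Q
  proof -
    have "\<forall>q\<in>Q. \<exists>d. d \<in> D \<and> (\<exists>l. q = bs l d)" using sub(2) unfolding S_def by blast
    \<comment> \<open>\<open>\<delta>\<close> projects a vertex of \<open>Q\<close> to the element
      of \<open>D\<close> of which it is a copy. It is injective because \<open>Q\<close> is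
      complete and copies of the same element are never adjacent.\<close>
    then obtain \<delta> where \<delta>: "\<And>q. q \<in> Q \<Longrightarrow> \<delta> q \<in> D \<and> (\<exists>l. q = bs l (\<delta> q))" by metis
    have P\<delta>: "E p (\<delta> q)" if "p \<in> P" "q \<in> Q" for p q
      using PQ that \<delta>[OF that(2)] coord unfolding N_def by metis
    have inj: "inj_on \<delta> Q"
    proof (rule inj_onI, rule ccontr)
      fix q q' assume q: "q \<in> Q" "q' \<in> Q" "\<delta> q = \<delta> q'" "q \<noteq> q'"
      then have "E q q'" using Q unfolding pairwise_def by blast
      then show False using \<delta>[OF q(1)] \<delta>[OF q(2)] q(3) nonadj by metis
    qed
    have \<delta>C: "\<delta> q = q" if "q \<in> Q" "q \<in> C" for q
    proof -
      have "q \<in> D" using that(2) CD by blast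
      then show ?thesis using \<delta>[OF that(1)] coord[of "\<delta> q" q] bs0[of q] by metis
    qed
    have \<delta>nC: "\<delta> q \<notin> C" if "q \<in> Q" "q \<notin> C" for q
      using \<delta>[OF that(1)] that(2) bsC by metis
    have Q\<delta>: "E q c \<longleftrightarrow> E (\<delta> q) c" if "q \<in> Q" "c \<in> C" for q c
      using \<delta>[OF that(1)] that(2) bs_EC by metis
    show False
    proof (cases "Q \<subseteq> C")
      case True
      have "pairwise E (P \<union> Q)"
        using P Q P\<delta> \<delta>C True E_sym unfolding pairwise_def by (metis Un_iff subsetD)
      moreover have "P \<inter> Q = {}" using sub(1) True unfolding W_def by blast
      ultimately show False using no_clique[of "P \<union> Q"] card fin by (simp add: card_Un_disjoint)
    next
      case False
      define Y where "Y = \<delta> ` (Q - C)"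
      \<comment> \<open>\<open>K_rel\<close> asks for no edges inside \<open>Y\<close>, so
        \<open>Z\<close> is a witness although elements of \<open>Y\<close> that come from different
        tuples may be nonadjacent.\<close>
      define Z where "Z = P \<union> \<delta> ` Q"
      have \<delta>Q: "\<delta> ` Q = Y \<union> (Q \<inter> C)"
      proof
        show "\<delta> ` Q \<subseteq> Y \<union> (Q \<inter> C)" unfolding Y_def using \<delta>C by auto
        show "Y \<union> (Q \<inter> C) \<subseteq> \<delta> ` Q" unfolding Y_def using \<delta>C by force
      qed
      have YD: "Y \<subseteq> D - C" unfolding Y_def using \<delta> \<delta>nC by blast
      have "\<delta> ` Q \<subseteq> D" using \<delta> by blast
      then have "P \<inter> \<delta> ` Q = {}" using sub(1) WD by blast
      then have cZ: "card Z = n" "finite Z"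
        using fin card card_image[OF inj] unfolding Z_def by (auto simp: card_Un_disjoint)
      have ZA: "Z \<inter> (a ` A \<union> C) = P \<union> (Q \<inter> C)"
        unfolding Z_def \<delta>Q using YD AD sub(1) unfolding W_def by blast
      have ZY: "Z \<inter> Y = Y" unfolding Z_def \<delta>Q by blast
      have "pairwise E (P \<union> (Q \<inter> C))"
        using P Q P\<delta> \<delta>C E_sym unfolding pairwise_def by (metis Int_iff Un_iff)
      moreover have "E x y" if x: "x \<in> Y" and y: "y \<in> P \<union> (Q \<inter> C)" for x y
      proof -
        obtain q where q: "q \<in> Q" "q \<notin> C" "x = \<delta> q" using x unfolding Y_def by blast
        show ?thesis
        proof (cases "y \<in> P")
          case True
          then show ?thesis using P\<delta> q E_sym by blast
        next
          case False
          then have "y \<in> Q" "y \<in> C" "q \<noteq> y" using y q by auto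
          then have "E q y" using q Q unfolding pairwise_def by blast
          then show ?thesis using Q\<delta> q \<open>y \<in> C\<close> by blast
        qed
      qed
      moreover have "Z \<subseteq> Y \<union> (a ` A \<union> C)" unfolding Z_def \<delta>Q using sub(1) unfolding W_def by blast
      moreover have "Y \<noteq> {}" using False unfolding Y_def by blast
      ultimately have "K_rel n E Y (a ` A \<union> C)"
        unfolding K_rel_def using cZ ZA ZY ne by (intro exI[of _ Z]) auto
      then have "K_rel n E Y C" using K YD by blast
      then obtain Z' where Z': "Z' \<subseteq> Y \<union> C" "finite Z'" "card Z' = n"
        "pairwise E (Z' \<inter> C)" "\<forall>x\<in>Z' \<inter> Y. \<forall>y\<in>Z' \<inter> C. E x y"
        unfolding K_rel_def by blast
      \<comment> \<open>Lifting \<open>Y\<close> back to \<open>Q\<close> supplies the edges missing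
        inside \<open>Y\<close>, since \<open>Q\<close> is complete; the witness over
        \<open>C\<close> thereby becomes a \<open>K\<^sub>n\<close> of \<open>E\<close>.\<close>
      define f where "f z = (if z \<in> C then z else inv_into Q \<delta> z)" for z
      have fY: "f z \<in> Q \<and> \<delta> (f z) = z \<and> z \<in> Y" if "z \<in> Z'" "z \<notin> C" for z
      proof -
        have "z \<in> Y" using that Z'(1) by blast
        then have "z \<in> \<delta> ` Q" unfolding Y_def by blast
        then show ?thesis using \<open>z \<in> Y\<close> that(2) unfolding f_def by (simp add: f_inv_into_f inv_into_into)
      qed
      have fC: "f z = z" if "z \<in> C" for z using that unfolding f_def by simp
      have mixed: "E (f x) (f y)" if "x \<in> Z'" "y \<in> Z'" "x \<notin> C" "y \<in> C" for x y
        using that fY[of x] fC[of y] Z'(5) Q\<delta>[of "f x" y] by auto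
      have "E (f x) (f y)" if xy: "x \<in> Z'" "y \<in> Z'" "x \<noteq> y" for x y
      proof (cases "x \<in> C"; cases "y \<in> C")
        assume "x \<in> C" "y \<in> C"
        then show ?thesis using xy Z'(4) fC unfolding pairwise_def by auto
      next
        assume "x \<notin> C" "y \<notin> C"
        then have "f x \<in> Q" "f y \<in> Q" "f x \<noteq> f y" using fY xy by metis+
        then show ?thesis using Q unfolding pairwise_def by blast
      qed (use mixed E_sym xy in blast)+
      then show False using no_clique_image Z'(2,3) by blast
    qed
  qed
  have W: "small \<kappa> W" unfolding W_def by (rule small_subset[OF small_image[OF A]]) auto
  have S: "small \<kappa> S" unfolding S_def by (rule small_UN_nat[OF D])
  have "\<exists>g. inj_on g W \<and> g ` W \<inter> S = {} \<and> (\<forall>w\<in>W. \<forall>w'\<in>W. E (g w) (g w') \<longleftrightarrow> E w w') \<and>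
      (\<forall>w\<in>W. \<forall>s\<in>S. E (g w) s \<longleftrightarrow> N w s)"
    by (rule amalgam[OF W S]) (erule (8) no_K)
  then obtain g where g: "inj_on g W" "g ` W \<inter> S = {}"
    "\<forall>w\<in>W. \<forall>w'\<in>W. E (g w) (g w') \<longleftrightarrow> E w w'" "\<forall>w\<in>W. \<forall>s\<in>S. E (g w) s \<longleftrightarrow> N w s"
    by blast
  \<comment> \<open>For each \<open>l\<close>, \<open>\<Theta> l\<close> embeds
    \<open>W \<union> D\<close>, using the new copy on \<open>W\<close> and the \<open>l\<close>-th
    tuple on \<open>D\<close>.\<close>
  define \<Theta> where "\<Theta> l v = (if v \<in> W then g v else bs l v)" for l v
  have bsS: "bs l d \<in> S" if "d \<in> D" for l d using that unfolding S_def by blast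
  have gE: "E (g w) (bs l d) \<longleftrightarrow> E w d" if "w \<in> W" "d \<in> D" for w l d
    using g(4)[rule_format, OF that(1) bsS[OF that(2)]] coord that(2) unfolding N_def by metis
  have gE': "E (bs l d) (g w) \<longleftrightarrow> E d w" if "w \<in> W" "d \<in> D" for w l d
    unfolding E_commute[of _ "g w"] E_commute[of d] by (rule gE[OF that])
  have g_ne: "g w \<noteq> bs l d" if "w \<in> W" "d \<in> D" for w l d
    using g(2) bsS[OF that(2), of l] that(1) by (metis disjoint_iff imageI)
  have \<Theta>: "(v = v' \<longleftrightarrow> \<Theta> l v = \<Theta> l v') \<and> (E v v' \<longleftrightarrow> E (\<Theta> l v) (\<Theta> l v'))"
    if "v \<in> W \<union> D" "v' \<in> W \<union> D" for v v' l
  proof -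
    have nW: "d \<notin> W" if "d \<in> D" for d using that WD by blast
    consider "v \<in> W" "v' \<in> W" | "v \<in> W" "v' \<in> D" | "v \<in> D" "v' \<in> W" | "v \<in> D" "v' \<in> D"
      using \<open>v \<in> W \<union> D\<close> \<open>v' \<in> W \<union> D\<close> by blast
    then show ?thesis
    proof cases
      case 1
      then show ?thesis using g(3) inj_onD[OF g(1)] unfolding \<Theta>_def by auto
    next
      case 2
      then show ?thesis using gE g_ne nW unfolding \<Theta>_def by auto
    next
      case 3
      then show ?thesis using gE' g_ne[OF 3(2,1), of l] nW unfolding \<Theta>_def by auto
    next
      case 4
      then show ?thesis using bs_eq bs_E nW unfolding \<Theta>_def by auto
    qed
  qed
  \<comment> \<open>The index \<open>0\<close> is arbitrary: on \<open>A\<close> the values of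
    \<open>a\<close> lie in \<open>W\<close> or \<open>C\<close>, where all
    \<open>\<Theta> l\<close> coincide.\<close>
  define r where "r x = \<Theta> 0 (a x)" for x
  have r: "case_sum r (bs l) u = \<Theta> l (case_sum a id u) \<and> case_sum a id u \<in> W \<union> D" if "u \<in> A <+> D" for u l
  proof (cases u)
    case (Inl x)
    then have "a x \<in> W \<or> a x \<in> C" using that unfolding W_def by auto
    then show ?thesis using Inl bsC CD unfolding r_def \<Theta>_def by auto
  next
    case (Inr d)
    then show ?thesis using that WD unfolding \<Theta>_def by auto
  qed
  have "same_atoms (A <+> D) (case_sum a id) (case_sum r (bs l))" for l
    unfolding same_atoms_def using r \<Theta> by metis
  then have "realizes E r (subst_params (bs l) ` tp E a A D)" for l
    by (rule realizes_tp)
  then have "realizes E r (\<Union>l. subst_params (bs l) ` tp E a A D)"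
    unfolding realizes_def by blast
  then show False using incons consistent_if_realizes by blast
qed

text \<open>Over each \<open>D\<close> the non-dividing extension is the type of a copy of
  \<open>A\<close> amalgamated freely with \<open>D\<close> over \<open>B \<union> C\<close>;
  \<open>not_divides\<close> applies once the condition is shown for that copy and
  \<open>D\<close>.\<close>

lemma indep_f_if_K_rel:
  assumes A: "small \<kappa> A" and AB: "A \<inter> B \<subseteq> C"
    and K: "\<And>Y. \<lbrakk>Y \<subseteq> B - C; K_rel n E Y (A \<union> C)\<rbrakk> \<Longrightarrow> K_rel n E Y C"
  shows "indep_f \<kappa> E A C B"
proof -
  have "\<exists>q. complete_type E A D q \<and> tp E id A (B \<union> C) \<subseteq> q \<and> \<not> divides E C q D id"
    if D: "small \<kappa> D" "B \<union> C \<subseteq> D" for D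
  proof -
    define W where "W = A - (B \<union> C)"
    have W: "small \<kappa> W" unfolding W_def by (rule small_subset[OF A]) auto
    \<comment> \<open>New vertices have neighbours in \<open>D\<close> only inside
      \<open>B \<union> C\<close>, so a nonempty \<open>P\<close> forces \<open>Q\<close> into
      \<open>B \<union> C\<close>, and \<open>P \<union> Q\<close> would already be a
      \<open>K\<^sub>n\<close> of \<open>E\<close>.\<close>
    have no_K: False if fin: "finite P" "finite Q" and sub: "P \<subseteq> W" "Q \<subseteq> D"
      and ne: "P \<noteq> {}" and card: "card P + card Q = n" and P: "pairwise E P" and Q: "pairwise E Q"
      and PQ: "\<forall>p\<in>P. \<forall>q\<in>Q. E p q \<and> q \<in> B \<union> C" for P Q
    proof -
      have "pairwise E (P \<union> Q)" using P Q PQ E_sym unfolding pairwise_def by (metis Un_iff)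
      moreover have "P \<inter> Q = {}" using sub(1) PQ ne unfolding W_def by blast
      ultimately show False using no_clique[of "P \<union> Q"] card fin by (simp add: card_Un_disjoint)
    qed
    have "\<exists>g. inj_on g W \<and> g ` W \<inter> D = {} \<and> (\<forall>w\<in>W. \<forall>w'\<in>W. E (g w) (g w') \<longleftrightarrow> E w w') \<and>
        (\<forall>w\<in>W. \<forall>d\<in>D. E (g w) d \<longleftrightarrow> E w d \<and> d \<in> B \<union> C)"
      by (rule amalgam[OF W D(1)]) (erule (8) no_K)
    then obtain g where g: "inj_on g W" "g ` W \<inter> D = {}"
      "\<forall>w\<in>W. \<forall>w'\<in>W. E (g w) (g w') \<longleftrightarrow> E w w'"
      "\<forall>w\<in>W. \<forall>d\<in>D. E (g w) d \<longleftrightarrow> E w d \<and> d \<in> B \<union> C"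
      by blast
    define a where "a v = (if v \<in> W then g v else v)" for v
    have a: "(v = v' \<longleftrightarrow> a v = a v') \<and> (E v v' \<longleftrightarrow> E (a v) (a v'))"
      if v: "v \<in> A \<union> B \<union> C" "v' \<in> A \<union> B \<union> C" for v v'
    proof -
      have nW: "u \<in> B \<union> C" "u \<in> D" if "u \<in> A \<union> B \<union> C" "u \<notin> W" for u
        using that D(2) unfolding W_def by blast+
      have g_ne: "g w \<noteq> d" if "w \<in> W" "d \<in> D" for w d using that g(2) by blast
      show ?thesis
      proof (cases "v \<in> W"; cases "v' \<in> W")
        assume "v \<in> W" "v' \<in> W"
        then show ?thesis using g(3) inj_onD[OF g(1)] unfolding a_def by auto
      next
        assume "v \<in> W" "v' \<notin> W"
        then show ?thesis using nW[OF v(2)] g(4) g_ne unfolding a_def by auto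
      next
        assume w: "v \<notin> W" "v' \<in> W"
        then have "E (g v') v \<longleftrightarrow> E v' v" using nW[OF v(1)] g(4) by blast
        then have "E v (g v') \<longleftrightarrow> E v v'" using E_commute by metis
        then show ?thesis using w nW[OF v(1)] g_ne[of v' v] unfolding a_def by auto
      qed (simp add: a_def)
    qed
    have aBC: "a v = v" if "v \<in> B \<union> C" for v using that unfolding a_def W_def by simp
    have "same_atoms (A <+> (B \<union> C)) (case_sum id id) (case_sum a id)"
    proof -
      have "case_sum a id u = a (case_sum id id u) \<and> case_sum id id u \<in> A \<union> B \<union> C"
        if "u \<in> A <+> (B \<union> C)" for u
        using that aBC by (cases u) auto
      then show ?thesis unfolding same_atoms_def using a by metis
    qed
    then have sub: "tp E id A (B \<union> C) \<subseteq> tp E a A D" using tp_subset D(2) by blast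
    have aD: "x \<in> C" if "x \<in> A" "a x \<in> D" for x
    proof -
      have "x \<notin> W" using that(2) g(2) unfolding a_def by auto
      then show ?thesis using that(1) AB unfolding W_def by blast
    qed
    have aAD: "a ` A \<inter> D \<subseteq> C" using aD aBC by force
    have "K_rel n E Y C" if Y: "Y \<subseteq> D - C" and KY: "K_rel n E Y (a ` A \<union> C)" for Y
    proof -
      obtain Z where Z: "Z \<subseteq> Y \<union> (a ` A \<union> C)" "finite Z" "card Z = n" "Z \<inter> (a ` A \<union> C) \<noteq> {}" "Z \<inter> Y \<noteq> {}"
        "pairwise E (Z \<inter> (a ` A \<union> C))" and ZE: "\<And>x y. \<lbrakk>x \<in> Z \<inter> Y; y \<in> Z \<inter> (a ` A \<union> C)\<rbrakk> \<Longrightarrow> E x y"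
        using KY unfolding K_rel_def by blast
      show ?thesis
      \<comment> \<open>If \<open>Z\<close> meets the copy of \<open>A\<close> only in
        \<open>C\<close>, it is already a witness over \<open>C\<close>. Otherwise it contains a new
        vertex, which is adjacent to all of \<open>Z \<inter> Y\<close> and thereby puts that set
        inside \<open>B\<close>.\<close>
      proof (cases "Z \<inter> a ` A \<subseteq> C")
        case True
        then have "Z \<subseteq> Y \<union> C" "Z \<inter> (a ` A \<union> C) = Z \<inter> C" using Z(1) by blast+
        then show ?thesis unfolding K_rel_def using Z ZE by (intro exI[of _ Z]) auto
      next
        case False
        then obtain x\<^sub>0 where x\<^sub>0: "x\<^sub>0 \<in> A" "a x\<^sub>0 \<in> Z" "a x\<^sub>0 \<notin> C" by blast
        then have x\<^sub>0W: "x\<^sub>0 \<in> W" unfolding a_def W_def using AB by (auto split: if_splits)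
        have ZB: "Z \<inter> Y \<subseteq> B - C"
        proof
          fix y assume y: "y \<in> Z \<inter> Y"
          then have "E (g x\<^sub>0) y" using ZE[OF y, of "a x\<^sub>0"] x\<^sub>0 x\<^sub>0W E_sym unfolding a_def by auto
          then show "y \<in> B - C" using g(4) x\<^sub>0W y Y by blast
        qed
        \<comment> \<open>The preimage of \<open>Z\<close> under the embedding \<open>a\<close> of
          \<open>A \<union> B \<union> C\<close> turns the configuration over the copy into one over
          \<open>A\<close> itself.\<close>
        define Z' where "Z' = {v \<in> A \<union> B \<union> C. a v \<in> Z}"
        have inj: "inj_on a Z'" unfolding Z'_def inj_on_def using a by blast
        have im: "a ` Z' = Z"
        proof
          show "Z \<subseteq> a ` Z'"
          proof
            fix z assume z: "z \<in> Z"
            then consider "z \<in> B \<union> C" | "z \<in> a ` A" using Z(1) ZB by blast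
            then show "z \<in> a ` Z'"
            proof cases
              case 1
              then show ?thesis using aBC[OF 1] z unfolding Z'_def by (intro rev_image_eqI[of z]) auto
            next
              case 2
              then show ?thesis using z unfolding Z'_def by blast
            qed
          qed
        qed (auto simp: Z'_def)
        have fin: "finite Z'" and card: "card Z' = n"
          using finite_imageD[OF _ inj] card_image[OF inj] im Z(2,3) by simp_all
        have aAC: "a v \<in> Z \<inter> (a ` A \<union> C)" if "v \<in> Z' \<inter> (A \<union> C)" for v
          using that aBC unfolding Z'_def by auto
        have "Z' \<subseteq> Z \<inter> Y \<union> (A \<union> C)"
        proof
          fix v assume v: "v \<in> Z'"
          show "v \<in> Z \<inter> Y \<union> (A \<union> C)"
          proof (cases "v \<in> A \<union> C")
            case False
            then have "a v = v" "v \<in> D" "v \<in> Z" using v aBC D(2) unfolding Z'_def by auto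
            then show ?thesis using Z(1) aAD by blast
          qed blast
        qed
        moreover have "Z' \<inter> (A \<union> C) \<noteq> {}" using x\<^sub>0 unfolding Z'_def by blast
        moreover have "Z' \<inter> (Z \<inter> Y) \<noteq> {}"
        proof -
          obtain z where z: "z \<in> Z \<inter> Y" using Z(5) by blast
          then have "z \<in> B" using ZB by blast
          then have "z \<in> Z'" using z aBC[of z] unfolding Z'_def by simp
          then show ?thesis using z by blast
        qed
        moreover have "pairwise E (Z' \<inter> (A \<union> C))"
        proof (rule pairwiseI)
          fix x y assume xy: "x \<in> Z' \<inter> (A \<union> C)" "y \<in> Z' \<inter> (A \<union> C)" "x \<noteq> y"
          then have "a x \<noteq> a y" using inj by (auto dest: inj_onD)
          with pairwiseD[OF Z(6) aAC[OF xy(1)] aAC[OF xy(2)]] have "E (a x) (a y)" .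
          moreover have "x \<in> A \<union> B \<union> C" "y \<in> A \<union> B \<union> C" using xy by auto
          ultimately show "E x y" using a[of x y] by simp
        qed
        moreover have "E x y" if "x \<in> Z' \<inter> (Z \<inter> Y)" "y \<in> Z' \<inter> (A \<union> C)" for x y
        proof -
          have "a x = x" using that(1) ZB aBC by blast
          then have "E (a x) (a y)" using ZE[of x "a y"] aAC[OF that(2)] that(1) by auto
          moreover have "x \<in> A \<union> B \<union> C" "y \<in> A \<union> B \<union> C" using that unfolding Z'_def by auto
          ultimately show ?thesis using a[of x y] by simp
        qed
        ultimately have "K_rel n E (Z \<inter> Y) (A \<union> C)"
          unfolding K_rel_def using fin card by (intro exI[of _ Z']) auto
        then have "K_rel n E (Z \<inter> Y) C" using K ZB by blast
        then show ?thesis using K_rel_mono Y by blast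
      qed
    qed
    then have "\<not> divides E C (tp E a A D) D id"
      using not_divides[OF A D(1) _ aAD] D(2) by blast
    then show ?thesis using sub complete_type_tp by blast
  qed
  then show ?thesis
    unfolding indep_f_def forks_def subst_params_id by auto
qed

section \<open>From independence to the combinatorial condition\<close>

text \<open>Copies of \<open>B\<close> over \<open>C\<close> with an edge between the copies of two distinct elements of \<open>X\<close> with
  distinct indices: transversals of the copies of \<open>X\<close> are complete, and \<open>K_rel n E X C\<close> is the only
  obstruction to the resulting graph being \<open>K\<^sub>n\<close>-free.\<close>

lemma ex_spread_sequence:
  assumes B: "small \<kappa> B" and C: "small \<kappa> C" and X: "X \<subseteq> B - C" "finite X" "card X < n"
    and K: "\<not> K_rel n E X C"
  shows "\<exists>bs. (\<forall>d\<in>B \<union> C. bs 0 d = d) \<and> (\<forall>l. \<forall>c\<in>C. bs l c = c) \<and> indiscernible E C (B \<union> C) bs \<and>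
    (\<forall>b\<in>B - C. \<forall>l m. l \<noteq> m \<longrightarrow> bs l b \<noteq> bs m b) \<and>
    (\<forall>x\<in>X. \<forall>y\<in>X. \<forall>l m. x \<noteq> y \<longrightarrow> l \<noteq> m \<longrightarrow> E (bs l x) (bs m y))"
proof -
  \<comment> \<open>\<open>C\<close> is kept once, with index \<open>0\<close>; each element of
    \<open>B - C\<close> gets a copy for every index.\<close>
  define V where "V = C \<times> {0} \<union> (B - C) \<times> (UNIV :: nat set)"
  define F where "F u v \<longleftrightarrow> (if fst u \<in> C \<or> fst v \<in> C \<or> snd u = snd v then E (fst u) (fst v)
    else fst u \<in> X \<and> fst v \<in> X \<and> fst u \<noteq> fst v)" for u v :: "'a \<times> nat"
  have "small \<kappa> V"
    unfolding V_def by (rule small_subset[OF small_Times_nat[OF small_Un[OF B C]]]) auto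
  have KV: "K_free_graph n V F"
    unfolding K_free_graph_def
  proof (intro conjI ballI impI notI)
    fix u v assume "F u v" then show "F v u"
      unfolding F_def using E_sym by (auto split: if_splits)
  next
    fix u assume "F u u" then show False
      unfolding F_def by (auto split: if_splits)
  next
    assume "\<exists>Z\<subseteq>V. finite Z \<and> card Z = n \<and> pairwise F Z"
    then obtain Z where Z: "Z \<subseteq> V" "finite Z" "card Z = n" and FZ: "\<And>u v. \<lbrakk>u \<in> Z; v \<in> Z; u \<noteq> v\<rbrakk> \<Longrightarrow> F u v"
      unfolding pairwise_def by blast
    \<comment> \<open>\<open>F\<close> never joins two copies of the same element, so a complete
      graph projects injectively.\<close>
    have "inj_on fst Z"
    proof (rule inj_onI, rule ccontr)
      fix u v assume "u \<in> Z" "v \<in> Z" "fst u = fst v" "u \<noteq> v"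
      then show False using FZ[of u v] unfolding F_def by (auto split: if_splits)
    qed
    then have card: "card (fst ` Z) = n" using Z(3) card_image by blast
    show False
    \<comment> \<open>With a single index outside \<open>C\<close> the projection is a
      \<open>K\<^sub>n\<close> of \<open>E\<close>. With two indices, every vertex outside
      \<open>C\<close> has an edge to one of another index and so lies over
      \<open>X\<close>.\<close>
    proof (cases "\<exists>u\<in>Z. \<exists>v\<in>Z. fst u \<notin> C \<and> fst v \<notin> C \<and> snd u \<noteq> snd v")
      case False
      then have "F u v \<longleftrightarrow> E (fst u) (fst v)" if "u \<in> Z" "v \<in> Z" for u v
        using that unfolding F_def by auto
      then show False using no_clique_image[OF Z(2,3), of fst] FZ by blast
    next
      case True
      then obtain u v where uv: "u \<in> Z" "v \<in> Z" "fst u \<notin> C" "fst v \<notin> C" "snd u \<noteq> snd v" by blast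
      have ZX: "fst w \<in> X" if w: "w \<in> Z" "fst w \<notin> C" for w
      proof -
        obtain w' where w': "w' \<in> Z" "fst w' \<notin> C" "snd w \<noteq> snd w'"
          using uv by (cases "snd w = snd u") auto
        then have "F w w'" using FZ w(1) by blast
        then show ?thesis using w w' unfolding F_def by simp
      qed
      have sub: "fst ` Z \<subseteq> X \<union> C" using ZX by blast
      have "fst u \<in> fst ` Z \<inter> X" using uv ZX by blast
      moreover have "fst ` Z \<inter> C \<noteq> {}"
      proof
        assume "fst ` Z \<inter> C = {}"
        then have "fst ` Z \<subseteq> X" using sub by blast
        from card_mono[OF X(2) this] show False using card X(3) by simp
      qed
      moreover have mixed: "E (fst x) (fst y)" if "x \<in> Z" "y \<in> Z" "fst y \<in> C" "x \<noteq> y" for x y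
        using FZ[of x y] that unfolding F_def by simp
      moreover have "pairwise E (fst ` Z \<inter> C)" unfolding pairwise_def using mixed by blast
      moreover have "E x y" if "x \<in> fst ` Z \<inter> X" "y \<in> fst ` Z \<inter> C" for x y
        using that X(1) mixed by blast
      ultimately have "K_rel n E X C"
        unfolding K_rel_def using sub card Z(2) by (intro exI[of _ "fst ` Z"]) auto
      then show False using K by blast
    qed
  qed
  have emb: "induced_embedding ((B \<union> C) \<times> {0}) F E fst"
    unfolding induced_embedding_def F_def by (auto simp: inj_on_def)
  have "(B \<union> C) \<times> {0} \<subseteq> V" unfolding V_def by auto
  from embed_small_K_free_graph[OF KV \<open>small \<kappa> V\<close> this emb]
  obtain g where g: "induced_embedding V F E g" and g0: "\<And>d. d \<in> B \<union> C \<Longrightarrow> g (d, 0) = d" by auto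
  have gi: "g u = g v \<longleftrightarrow> u = v" "E (g u) (g v) \<longleftrightarrow> F u v" if "u \<in> V" "v \<in> V" for u v
    using g that unfolding induced_embedding_def by (auto dest: inj_onD)
  define idx where "idx l d = (d, if d \<in> C then 0 else l)" for l :: nat and d
  define bs where "bs l d = g (idx l d)" for l d
  have V: "idx l d \<in> V" if "d \<in> B \<union> C" for l d
    using that unfolding V_def idx_def by auto
  have bs_eq: "bs l d = bs m e \<longleftrightarrow> d = e \<and> (d \<in> C \<or> l = m)"
    and bs_E: "E (bs l d) (bs m e) \<longleftrightarrow> F (idx l d) (idx m e)" if "d \<in> B \<union> C" "e \<in> B \<union> C" for d e l m
    unfolding bs_def using gi[OF V[OF that(1)] V[OF that(2)]] by (auto simp: idx_def)
  have bsC: "bs l c = c" if "c \<in> C" for l c unfolding bs_def idx_def using that g0 by simp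
  have "indiscernible E C (B \<union> C) bs"
    unfolding indiscernible_def
  proof (intro allI impI tp_eq)
    fix k :: nat and f h :: "nat \<Rightarrow> nat"
    assume fh: "strict_mono_on {..<k} f" "strict_mono_on {..<k} h"
    \<comment> \<open>Equality and adjacency of entries depend on the indices only through which of
      them coincide, and both index maps are injective on \<open>{..<k}\<close>.\<close>
    have inj: "f i = f j \<longleftrightarrow> h i = h j" if "i < k" "j < k" for i j
      using that fh[THEN strict_mono_on_imp_inj_on] by (auto dest: inj_onD)
    define \<tau> where "\<tau> f = case_sum (\<lambda>(m, y). bs (f m) y) id" for f :: "nat \<Rightarrow> nat"
    define ix :: "nat \<times> 'a + 'a \<Rightarrow> nat \<times> 'a" where "ix = case_sum (\<lambda>p. p) (\<lambda>c. (0 :: nat, c))"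
    have \<tau>: "\<tau> f' u = bs (f' (fst (ix u))) (snd (ix u))" if "u \<in> {..<k} \<times> (B \<union> C) <+> C" for u f'
      using that bsC unfolding \<tau>_def ix_def by (cases u) (auto split: prod.splits)
    have ix: "snd (ix u) \<in> B \<union> C" "snd (ix u) \<in> C \<or> fst (ix u) < k" if "u \<in> {..<k} \<times> (B \<union> C) <+> C" for u
      using that unfolding ix_def by auto
    have "(\<tau> f u = \<tau> f v \<longleftrightarrow> \<tau> h u = \<tau> h v) \<and> (E (\<tau> f u) (\<tau> f v) \<longleftrightarrow> E (\<tau> h u) (\<tau> h v))"
      if uv: "u \<in> {..<k} \<times> (B \<union> C) <+> C" "v \<in> {..<k} \<times> (B \<union> C) <+> C" for u v
      unfolding \<tau>[OF uv(1)] \<tau>[OF uv(2)] bs_eq[OF ix(1)[OF uv(1)] ix(1)[OF uv(2)]]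
        bs_E[OF ix(1)[OF uv(1)] ix(1)[OF uv(2)]]
      using inj ix(2)[OF uv(1)] ix(2)[OF uv(2)] unfolding F_def idx_def by auto
    then show "same_atoms ({..<k} \<times> (B \<union> C) <+> C) (case_sum (\<lambda>(m, y). bs (f m) y) id)
        (case_sum (\<lambda>(m, y). bs (h m) y) id)"
      unfolding same_atoms_def \<tau>_def by blast
  qed
  moreover have "bs 0 d = d" if "d \<in> B \<union> C" for d
    unfolding bs_def idx_def using that g0 by simp
  moreover have "bs l b \<noteq> bs m b" if "b \<in> B - C" "l \<noteq> m" for b l m
    using bs_eq that by blast
  moreover have "E (bs l x) (bs m y)" if "x \<in> X" "y \<in> X" "x \<noteq> y" "l \<noteq> m" for x y l m
  proof -
    have "x \<in> B - C" "y \<in> B - C" using that X(1) by auto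
    then show ?thesis using that bs_E[of x y l m] unfolding F_def idx_def by auto
  qed
  ultimately show ?thesis using bsC by blast
qed

lemma indep_dD:
  assumes "indep_d E A C B" "\<forall>d\<in>B \<union> C. bs 0 d = d" "indiscernible E C (B \<union> C) bs"
  shows "consistent E (\<Union>l. subst_params (bs l) ` tp E id A (B \<union> C))"
  using assms unfolding indep_d_def divides_def by auto

text \<open>A common element \<open>a\<close> outside \<open>C\<close> would force one realization
  to equal both \<open>bs 0 a\<close> and \<open>bs 1 a\<close>, which the spread sequence keeps
  distinct.\<close>

lemma Int_subset_if_indep_d:
  assumes B: "small \<kappa> B" and C: "small \<kappa> C" and indep: "indep_d E A C B"
  shows "A \<inter> B \<subseteq> C"
proof
  fix a assume a: "a \<in> A \<inter> B"
  have "\<not> K_rel n E {} C" unfolding K_rel_def by blast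
  then obtain bs where bs: "\<forall>d\<in>B \<union> C. bs 0 d = d" "indiscernible E C (B \<union> C) bs"
    "\<forall>b\<in>B - C. \<forall>l m. l \<noteq> m \<longrightarrow> bs l b \<noteq> bs m b"
    using ex_spread_sequence[OF B C, of "{}"] n_pos by auto
  obtain r where r: "\<forall>(l, u, v)\<in>{0, 1 :: nat} \<times> {(Inl a, Inr a)}.
      case_sum id id u = case_sum id id v \<longrightarrow> case_sum r (bs l) u = case_sum r (bs l) v"
    using consistent_tp_atoms[OF indep_dD[OF indep bs(1,2)], of "{0, 1} \<times> {(Inl a, Inr a)}"] a
    by auto
  then have "r a = bs 0 a" "r a = bs 1 a" by auto
  then show "a \<in> C" using bs(3) a by (metis DiffI IntD2 zero_neq_one)
qed

text \<open>Along the spread sequence a realization is joined to all copies of its prescribed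
  neighbours in \<open>X\<close>. Copies of distinct elements with distinct indices are adjacent, so
  a transversal, the realization and the part in \<open>C\<close> form a
  \<open>K\<^sub>n\<close>.\<close>

lemma K_rel_if_indep_d:
  assumes B: "small \<kappa> B" and C: "small \<kappa> C" and indep: "indep_d E A C B"
    and Y: "Y \<subseteq> B - C" and KY: "K_rel n E Y (A \<union> C)"
  shows "K_rel n E Y C"
proof (rule ccontr)
  assume nK: "\<not> K_rel n E Y C"
  have AB: "A \<inter> B \<subseteq> C" using Int_subset_if_indep_d[OF B C indep] .
  obtain Z where Z: "Z \<subseteq> Y \<union> (A \<union> C)" "finite Z" "card Z = n" "Z \<inter> (A \<union> C) \<noteq> {}" "Z \<inter> Y \<noteq> {}"
    "pairwise E (Z \<inter> (A \<union> C))" and ZE: "\<And>x y. \<lbrakk>x \<in> Z \<inter> Y; y \<in> Z \<inter> (A \<union> C)\<rbrakk> \<Longrightarrow> E x y"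
    using KY unfolding K_rel_def by blast
  \<comment> \<open>Cutting \<open>Y\<close> down to the part met by \<open>Z\<close> leaves fewer
    than \<open>n\<close> elements, as \<open>Z\<close> also meets \<open>A \<union> C\<close>, and
    monotonicity keeps \<open>K_rel\<close> over \<open>C\<close> false.\<close>
  define X where "X = Z \<inter> Y"
  have X: "X \<subseteq> B - C" "finite X" using Y Z(2) unfolding X_def by auto
  have "X \<subset> Z" using Z(4) Y AB unfolding X_def by blast
  then have cX: "card X < n" using psubset_card_mono[OF Z(2)] Z(3) by blast
  have nKX: "\<not> K_rel n E X C"
    using nK K_rel_mono[of X C Y] Y unfolding X_def by blast
  obtain bs where bs: "\<forall>d\<in>B \<union> C. bs 0 d = d" "\<forall>l. \<forall>c\<in>C. bs l c = c"
      "indiscernible E C (B \<union> C) bs"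
    and spread: "\<forall>x\<in>X. \<forall>y\<in>X. \<forall>l m. x \<noteq> y \<longrightarrow> l \<noteq> m \<longrightarrow> E (bs l x) (bs m y)"
    using ex_spread_sequence[OF B C X cX nKX] by blast
  \<comment> \<open>Distinct elements of \<open>X\<close> get distinct indices, so the vertices
    \<open>bs (h x) x\<close> are pairwise adjacent.\<close>
  obtain h :: "'a \<Rightarrow> nat" where h: "inj_on h X" using finite_imp_inj_to_nat_seg[OF X(2)] by blast
  define A\<^sub>0 where "A\<^sub>0 = Z - X - C"
  have A\<^sub>0: "A\<^sub>0 \<subseteq> A" unfolding A\<^sub>0_def X_def using Z(1) by blast
  \<comment> \<open>Elements of \<open>A\<^sub>0\<close> enter as variables, the rest of
    \<open>Z\<close> as parameters. \<open>T\<close> then reads the edge between \<open>z\<close>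
    and \<open>z'\<close> in the copy of index \<open>h z'\<close>, the one from which
    \<open>z'\<close> is taken.\<close>
  define \<iota> :: "'a \<Rightarrow> 'a + 'a" where "\<iota> z = (if z \<in> A\<^sub>0 then Inl z else Inr z)" for z
  define T where "T = (\<lambda>(z, z'). (h z', \<iota> z, \<iota> z')) ` (A\<^sub>0 \<times> Z)"
  have \<iota>: "\<iota> z \<in> A <+> (B \<union> C)" if "z \<in> Z" for z
    using that A\<^sub>0 X(1) unfolding \<iota>_def A\<^sub>0_def by auto
  have T: "u \<in> A <+> (B \<union> C) \<and> v \<in> A <+> (B \<union> C)" if "(l, u, v) \<in> T" for l u v
    using that \<iota> unfolding T_def A\<^sub>0_def by auto
  have "finite T" unfolding T_def A\<^sub>0_def using Z(2) by simp
  from consistent_tp_atoms[OF indep_dD[OF indep bs(1,3)] this T]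
  obtain r where r: "\<forall>(l, u, v)\<in>T. E (case_sum id id u) (case_sum id id v) \<longrightarrow>
      E (case_sum r (bs l) u) (case_sum r (bs l) v)"
    by fastforce
  define f where "f z = case_sum r (bs (h z)) (\<iota> z)" for z
  have fA: "f z = r z" if "z \<in> A\<^sub>0" for z using that unfolding f_def \<iota>_def by simp
  have fX: "f z = bs (h z) z" if "z \<in> X" for z using that unfolding f_def \<iota>_def A\<^sub>0_def by simp
  have fC: "f z = z" if "z \<in> C" for z using that bs(2) unfolding f_def \<iota>_def A\<^sub>0_def by simp
  have \<iota>_id: "case_sum id id (\<iota> z) = z" for z unfolding \<iota>_def by simp
  have EZ: "E z z'" if "z \<in> Z" "z' \<in> Z" "z \<noteq> z'" "z \<notin> X" for z z'
  proof -
    have z: "z \<in> Z \<inter> (A \<union> C)" using that Z(1) unfolding X_def by blast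
    show ?thesis
    proof (cases "z' \<in> X")
      case True
      then show ?thesis using ZE[of z' z] z E_sym unfolding X_def by blast
    next
      case False
      then have "z' \<in> Z \<inter> (A \<union> C)" using that Z(1) unfolding X_def by blast
      then show ?thesis using Z(6) z that(3) unfolding pairwise_def by blast
    qed
  qed
  have A\<^sub>0E: "E (f z) (f z')" if "z \<in> A\<^sub>0" "z' \<in> Z" "z \<noteq> z'" for z z'
  proof -
    have "(h z', \<iota> z, \<iota> z') \<in> T" unfolding T_def using that by (intro image_eqI[of _ _ "(z, z')"]) auto
    moreover have "E z z'" using EZ that unfolding A\<^sub>0_def by blast
    ultimately have "E (case_sum r (bs (h z')) (\<iota> z)) (f z')"
      using bspec[OF r, of "(h z', \<iota> z, \<iota> z')"] \<iota>_id unfolding f_def by simp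
    then show ?thesis using fA that(1) unfolding \<iota>_def by simp
  qed
  have CX: "E (f z) (f z')" if "z \<in> Z" "z \<in> C" "z' \<in> X" for z z'
  proof -
    have z': "z' \<in> B \<union> C" "z' \<in> Z" using that X(1) unfolding X_def by auto
    have "z \<notin> X" using that X(1) by blast
    then have "E z' z" using EZ[of z z'] that z' E_sym by blast
    then have "E (bs 0 z') z" using bs(1) z' by simp
    then have "E (bs (h z') z') z" using indiscernible_single(4)[OF bs(3) z'(1) that(2)] by blast
    then show ?thesis using fX fC that E_sym by simp
  qed
  have "E (f z) (f z')" if z: "z \<in> Z" "z' \<in> Z" "z \<noteq> z'" for z z'
  proof -
    consider "z \<in> A\<^sub>0" | "z' \<in> A\<^sub>0" | "z \<in> X" "z' \<in> X" | "z \<in> C" "z' \<in> X" | "z \<in> X" "z' \<in> C" | "z \<in> C" "z' \<in> C"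
      using z unfolding A\<^sub>0_def by blast
    then show ?thesis
    proof cases
      case 1
      then show ?thesis using A\<^sub>0E z by blast
    next
      case 2
      then show ?thesis using A\<^sub>0E[of z' z] z E_sym by blast
    next
      case 3
      then have "h z \<noteq> h z'" using h z(3) by (auto dest: inj_onD)
      then show ?thesis using 3 spread z(3) fX by simp
    next
      case 4
      then show ?thesis using CX z by blast
    next
      case 5
      then show ?thesis using CX[of z' z] z E_sym by blast
    next
      case 6
      then have "z \<notin> X" using X(1) by blast
      then show ?thesis using 6 EZ z fC by simp
    qed
  qed
  then show False using no_clique_image[OF Z(2,3)] by blast
qed

text \<open>A sequence witnessing that a type divides also does so for every larger type, so
  \<open>D = B \<union> C\<close> witnesses forking.\<close>

lemma indep_d_if_indep_f:
  assumes "small \<kappa> B" "small \<kappa> C" "indep_f \<kappa> E A C B"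
  shows "indep_d E A C B"
  unfolding indep_d_def
proof
  assume "divides E C (tp E id A (B \<union> C)) (B \<union> C) id"
  then obtain bs where bs: "\<forall>d\<in>B \<union> C. bs 0 d = id d" "indiscernible E C (B \<union> C) bs"
    "\<not> consistent E (\<Union>l. subst_params (bs l) ` tp E id A (B \<union> C))"
    unfolding divides_def by blast
  have "divides E C q (B \<union> C) id" if "tp E id A (B \<union> C) \<subseteq> q" for q
  proof -
    have "(\<Union>l. subst_params (bs l) ` tp E id A (B \<union> C)) \<subseteq> (\<Union>l. subst_params (bs l) ` q)"
      using that by blast
    then have "\<not> consistent E (\<Union>l. subst_params (bs l) ` q)"
      using bs(3) unfolding consistent_def by (meson order_trans)
    then show ?thesis using bs(1,2) unfolding divides_def by blast
  qed
  then have "forks \<kappa> E C A (tp E id A (B \<union> C)) (B \<union> C) id"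
    unfolding forks_def subst_params_id using small_Un[OF assms(1,2)] by (intro exI[of _ "B \<union> C"]) auto
  then show False using assms(3) unfolding indep_f_def by blast
qed

end

theorem theorem5p3:
  fixes n :: nat
    and G :: "'g \<Rightarrow> 'g \<Rightarrow> bool"
    and \<kappa> :: "'k rel"
    and E :: "'a \<Rightarrow> 'a \<Rightarrow> bool"
    and A B C :: "'a set"
  assumes "n \<ge> 3"
    and "henson_graph n G"
    and "monster_model \<kappa> (complete_theory G) E"
    and "small \<kappa> A" and "small \<kappa> B" and "small \<kappa> C"
  shows "(indep_f \<kappa> E A C B \<longleftrightarrow> indep_d E A C B) \<and>
         (indep_d E A C B \<longleftrightarrow>
            A \<inter> B \<subseteq> C \<and>
            (\<forall>bs. set bs \<subseteq> B - C \<longrightarrow> K_rel n E (set bs) (A \<union> C) \<longrightarrow> K_rel n E (set bs) C))"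
proof -
  have models: "models E (complete_theory G)" and "Card_order \<kappa>" "natLeq <o \<kappa>" "saturated \<kappa> E"
    using assms(3) unfolding monster_model_def by blast+
  moreover have "K_free_graph n UNIV E"
    using K_free_graph_transfer[OF models] assms(2) unfolding henson_graph_def by simp
  moreover have "\<exists>a. a \<notin> F \<and> (\<forall>x\<in>F. E a x \<longleftrightarrow> x \<in> U)"
    if "finite F" "U \<subseteq> F" "\<And>Q. \<lbrakk>Q \<subseteq> U; card Q = n - 1\<rbrakk> \<Longrightarrow> \<not> pairwise E Q" for F U
    using extension_property_transfer[OF models assms(2) that] assms(1) by simp
  ultimately interpret saturated_generic_K_free_graph n E \<kappa>
    using assms(1) by unfold_locales auto
  \<comment> \<open>The implications close a cycle: non-forking gives non-dividing, which gives the
    combinatorial condition, which gives non-forking.\<close>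
  show ?thesis
    unfolding K_rel_lists_iff_subsets
    using indep_d_if_indep_f[OF assms(5,6), of A] Int_subset_if_indep_d[OF assms(5,6), of A]
      K_rel_if_indep_d[OF assms(5,6), of A] indep_f_if_K_rel[OF assms(4), of B C]
    by blast
qed

end
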